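(* Let $M\in{k^*}^2$ (a nonzero square), let $\mathcal{O}_M=\{P\in S^3((k^2)^* ): Q_n(P)=M\}$ and let $\mathcal{O}_M/\mathrm{Sl}(2,k)$ be the space of $\mathrm{Sl}(2,k)$-orbits in $\mathcal{O}_M$. (i) The map $I_{\mathcal{O}_{[1]}}:\mathcal{O}_{[1]}\to k^*\times_{Z_2}k^*/{k^*}^3$ induces a bijection from $\mathcal{O}_M/\mathrm{Sl}(2,k)$ onto $sq^{-1}(M)$ and, by pullback of the group structure $[q,\alpha]\times[q,\beta]=[q,\alpha\beta]$ on $sq^{-1}(M)$ (where $q^2=M$), a group structure on $\mathcal{O}_M/\mathrm{Sl}(2,k)$. (ii) As groups, $\mathcal{O}_M/\mathrm{Sl}(2,k)\cong k^*/{k^*}^3$. (iii) Let $q\in k^*$ be a square root of $M$. The identity element of $\mathcal{O}_M/\mathrm{Sl}(2,k)$ is characterised as follows: for $P\in\mathcal{O}_M$, $$\mathrm{Sl}(2,k)\cdot P=1\iff P\text{ is reducible over }k\iff I_{\mathcal{O}_{[1]}}(P)=[q,1].$$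
   Context: $k$ is a field of characteristic different from $2$ and $3$; $x,y$ is the standard coordinate basis of $(k^2)^*$; $S^3((k^2)^* )=\{ax^3+3bx^2y+3cxy^2+dy^3: a,b,c,d\in k\}$ is the space of binary cubics. $\mathrm{Sl}(2,k)$ acts on $(k^2)^*$ by transpose inverse, $(g\cdot\phi)(v)=\phi(g^{-1}v)$, and functorially on $S^3((k^2)^* )$. The symplectic form on $S^3((k^2)^* )$ is $\omega(P,P')=ad'-da'-3bc'+3cb'$ for $P=ax^3+3bx^2y+3cxy^2+dy^3$, $P'=a'x^3+3b'x^2y+3c'xy^2+d'y^3$. The normalised quartic is $Q_n(P)=a^2d^2-3b^2c^2-6abcd+4b^3d+4ac^3$, and $\mathcal{O}_{[1]}=\{P\in S^3((k^2)^* ): Q_n(P)\text{ is a square in }k^*\}$. $T=\{\lambda\phi^3:\lambda\in k^*,\ 0\ne\phi\in(k^2)^*\}$, and $I_T:T\to k^*/{k^*}^3$ is the well-defined map $I_T(\lambda\phi^3)=[\lambda]$. Every $P\in\mathcal{O}_{[1]}$ can be written $P=T_1+T_2$ with $T_1,T_2\in T$ coprime, unique up to permutation, and $Q_n(P)=\omega(T_1,T_2)^2$. $k^*\times_{Z_2}k^*/{k^*}^3$ denotes the quotient of $k^*\times (k^*/{k^*}^3)$ by the action of $Z_2=\{\pm1\}$ given by $-1\cdot(\lambda,\alpha)=(-\lambda,\alpha^{-1})$; the class of $(\lambda,\alpha)$ is written $[\lambda,\alpha]$. The map $I_{\mathcal{O}_{[1]}}$ is defined by $I_{\mathcal{O}_{[1]}}(P)=[\omega(T_1,T_2),\,I_T(T_1)I_T(T_2)^{-1}]$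 where $P=T_1+T_2$ with $T_1,T_2\in T$ coprime; it is $\mathrm{Sl}(2,k)$-invariant. The map $sq:k^*\times_{Z_2}k^*/{k^*}^3\to{k^*}^2$ is $sq([q,\alpha])=q^2$. Each fibre $sq^{-1}(q^2)$ has the group structure $[q,\alpha]\times[q,\beta]=[q,\alpha\beta]$, which is independent of the choice of the square root $q$ of $q^2$ and has identity $[q,1]$. *)

theory Defs
  imports
    "HOL-Analysis.Determinants"
    "HOL-Algebra.Group_Action"
    "HOL-Algebra.Sym_Groups"
    "HOL-Computational_Algebra.Polynomial_Factorial"
begin

section \<open>Binary cubics\<close>

text \<open>
  The polynomial ring \<open>k[x,y]\<close> is \<open>k[y][x]\<close>, i.e. \<open>'a poly poly\<close> with \<open>x\<close> as the outer and
  \<open>y\<close> as the inner variable; the coefficient of \<open>x\<^sup>i y\<^sup>j\<close> in \<open>P\<close> is \<open>coeff (coeff P i) j\<close>.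
\<close>

definition const :: "'a::field \<Rightarrow> 'a poly poly"
  where "const a = [:[:a:]:]"

definition varx :: "'a::field poly poly"
  where "varx = [:0, 1:]"

definition vary :: "'a::field poly poly"
  where "vary = [:[:0, 1:]:]"

definition subst2 :: "'a::field poly poly \<Rightarrow> 'a poly poly \<Rightarrow> 'a poly poly \<Rightarrow> 'a poly poly"
  where "subst2 P X Y = poly (map_poly (\<lambda>c. poly (map_poly const c) Y) P) X"

definition eval2 :: "'a::field poly poly \<Rightarrow> 'a^2 \<Rightarrow> 'a"
  where "eval2 P v = poly (poly P [:v $ 1:]) (v $ 2)"

text \<open>The linear form \<open>v \<mapsto> c\<^sub>1 v\<^sub>1 + c\<^sub>2 v\<^sub>2\<close>, an element of the dual space of \<open>k\<^sup>2\<close>.\<close>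

definition linform :: "'a::field ^ 2 \<Rightarrow> 'a poly poly"
  where "linform c = const (c $ 1) * varx + const (c $ 2) * vary"

definition cubic :: "'a::field \<Rightarrow> 'a \<Rightarrow> 'a \<Rightarrow> 'a \<Rightarrow> 'a poly poly"
  where "cubic a b c d = const a * varx ^ 3 + const (3 * b) * varx\<^sup>2 * vary
                       + const (3 * c) * varx * vary\<^sup>2 + const d * vary ^ 3"

definition S3 :: "'a::field poly poly set"
  where "S3 = {cubic a b c d | a b c d. True}"

text \<open>The coordinates \<open>a, b, c, d\<close> of \<open>a x\<^sup>3 + 3 b x\<^sup>2 y + 3 c x y\<^sup>2 + d y\<^sup>3\<close>
  (meaningful when 3 is invertible).\<close>

definition ca :: "'a::field poly poly \<Rightarrow> 'a" where "ca P = coeff (coeff P 3) 0"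
definition cb :: "'a::field poly poly \<Rightarrow> 'a" where "cb P = coeff (coeff P 2) 1 / 3"
definition cc :: "'a::field poly poly \<Rightarrow> 'a" where "cc P = coeff (coeff P 1) 2 / 3"
definition cd :: "'a::field poly poly \<Rightarrow> 'a" where "cd P = coeff (coeff P 0) 3"

definition omega :: "'a::field poly poly \<Rightarrow> 'a poly poly \<Rightarrow> 'a"
  where "omega P P' = ca P * cd P' - cd P * ca P' - 3 * cb P * cc P' + 3 * cc P * cb P'"

definition Qn :: "'a::field poly poly \<Rightarrow> 'a"
  where "Qn P = (ca P)\<^sup>2 * (cd P)\<^sup>2 - 3 * (cb P)\<^sup>2 * (cc P)\<^sup>2 - 6 * ca P * cb P * cc P * cd P
              + 4 * (cb P) ^ 3 * cd P + 4 * ca P * (cc P) ^ 3"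

definition nonzero_squares :: "'a::field set"
  where "nonzero_squares = {q\<^sup>2 | q. q \<noteq> 0}"

definition O1 :: "'a::field poly poly set"
  where "O1 = {P \<in> S3. Qn P \<in> nonzero_squares}"

definition OM :: "'a::field \<Rightarrow> 'a poly poly set"
  where "OM M = {P \<in> S3. Qn P = M}"


section \<open>The action of the special linear group\<close>

definition SL2 :: "('a::field ^ 2 ^ 2) monoid"
  where "SL2 = \<lparr>carrier = {g. det g = 1}, mult = (**), one = mat 1\<rparr>"

text \<open>
  The coordinate form \<open>x\<close> is sent to \<open>v \<mapsto> (g\<^sup>-\<^sup>1 v)\<^sub>1\<close>, whose coefficient vector is the first row
  of \<open>g\<^sup>-\<^sup>1\<close>; likewise \<open>y\<close> is sent to the form given by the second row.
\<close>

definition SL2_act :: "'a::field ^ 2 ^ 2 \<Rightarrow> 'a poly poly \<Rightarrow> 'a poly poly"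
  where "SL2_act g P = subst2 P (linform (row 1 (matrix_inv g))) (linform (row 2 (matrix_inv g)))"

lemma eval2_linform: "eval2 (linform c) v = c $ 1 * v $ 1 + c $ 2 * v $ 2"
  by (simp add: eval2_def linform_def const_def varx_def vary_def algebra_simps)

lemma eval2_subst2: "eval2 (subst2 P X Y) v = eval2 P (vector [eval2 X v, eval2 Y v])"
proof -
  have inner: "eval2 (poly (map_poly const c) Y) v = poly c (eval2 Y v)" for c :: "'a poly"
    by (induction c) (simp_all add: eval2_def const_def map_poly_pCons)
  show ?thesis
  proof (induction P)
    case 0
    then show ?case by (simp add: subst2_def eval2_def)
  next
    case (pCons c P)
    then show ?case
      using inner[of c] by (simp add: subst2_def eval2_def map_poly_pCons vector_2)
  qed
qed

lemma eval2_SL2_act: "eval2 (SL2_act g P) v = eval2 P (matrix_inv g *v v)"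
proof -
  have "vector [eval2 (linform (row 1 (matrix_inv g))) v, eval2 (linform (row 2 (matrix_inv g))) v]
      = matrix_inv g *v v"
    by (simp add: vec_eq_iff forall_2 vector_2 eval2_linform row_def matrix_vector_mult_def sum_2)
  then show ?thesis
    by (simp add: SL2_act_def eval2_subst2)
qed

abbreviation SL2_orbit :: "'a::field poly poly \<Rightarrow> 'a poly poly set"
  where "SL2_orbit \<equiv> orbit SL2 SL2_act"

abbreviation SL2_orbits :: "'a::field \<Rightarrow> 'a poly poly set set"
  where "SL2_orbits M \<equiv> orbits SL2 (OM M) SL2_act"


section \<open>Cube classes and the target of the invariant\<close>

definition kstar :: "'a::field monoid"
  where "kstar = \<lparr>carrier = {a. a \<noteq> 0}, mult = (*), one = 1\<rparr>"

definition cubes :: "'a::field set"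
  where "cubes = {a ^ 3 | a. a \<noteq> 0}"

definition cube_classes :: "'a::field set monoid"
  where "cube_classes = kstar Mod cubes"

definition cube_class :: "'a::field \<Rightarrow> 'a set"
  where "cube_class a = cubes #>\<^bsub>kstar\<^esub> a"

text \<open>\<open>sign_img\<close> is the group with carrier \<open>{-1, 1}\<close> under integer multiplication.\<close>

definition Z2_act :: "int \<Rightarrow> 'a::field \<times> 'a set \<Rightarrow> 'a \<times> 'a set"
  where "Z2_act s = (\<lambda>(l, \<alpha>). if s = -1 then (- l, inv\<^bsub>cube_classes\<^esub> \<alpha>) else (l, \<alpha>))"

definition twisted :: "('a::field \<times> 'a set) set set"
  where "twisted = orbits sign_img (carrier kstar \<times> carrier cube_classes) Z2_act"

definition tw :: "'a::field \<Rightarrow> 'a set \<Rightarrow> ('a \<times> 'a set) set"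
  where "tw l \<alpha> = orbit sign_img Z2_act (l, \<alpha>)"

definition sq :: "('a::field \<times> 'a set) set \<Rightarrow> 'a"
  where "sq u = the_elem ((\<lambda>(q, \<alpha>). q\<^sup>2) ` u)"

definition fibre :: "'a::field \<Rightarrow> ('a \<times> 'a set) set set"
  where "fibre M = {u \<in> twisted. sq u = M}"

text \<open>The group structure on the fibre of \<open>sq\<close> over \<open>M\<close>; by the \<open>THE\<close> the product does not
  depend on which square root \<open>q\<close> of \<open>M\<close> is used.\<close>

definition fibre_group :: "'a::field \<Rightarrow> ('a \<times> 'a set) set monoid"
  where "fibre_group M =
    \<lparr>carrier = fibre M,
     mult = (\<lambda>u v. THE w. \<exists>q \<alpha> \<beta>. q\<^sup>2 = M \<and> \<alpha> \<in> carrier cube_classes \<and> \<beta> \<in> carrier cube_classes \<and>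
               u = tw q \<alpha> \<and> v = tw q \<beta> \<and> w = tw q (\<alpha> \<otimes>\<^bsub>cube_classes\<^esub> \<beta>)),
     one = (THE e. \<exists>q. q\<^sup>2 = M \<and> e = tw q \<one>\<^bsub>cube_classes\<^esub>)\<rparr>"


section \<open>The invariant\<close>

definition Tset :: "'a::field poly poly set"
  where "Tset = {const l * linform c ^ 3 | l c. l \<noteq> 0 \<and> c \<noteq> 0}"

definition I_T :: "'a::field poly poly \<Rightarrow> 'a set"
  where "I_T t = (THE \<alpha>. \<exists>l c. l \<noteq> 0 \<and> c \<noteq> 0 \<and> t = const l * linform c ^ 3 \<and> \<alpha> = cube_class l)"

definition I_O1 :: "'a::field poly poly \<Rightarrow> ('a \<times> 'a set) set"
  where "I_O1 = (\<lambda>P\<in>O1. THE u. \<exists>T1 T2. T1 \<in> Tset \<and> T2 \<in> Tset \<and> coprime T1 T2 \<and> P = T1 + T2 \<and>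
           u = tw (omega T1 T2) (I_T T1 \<otimes>\<^bsub>cube_classes\<^esub> inv\<^bsub>cube_classes\<^esub> (I_T T2)))"

definition I_orb :: "'a::field poly poly set \<Rightarrow> ('a \<times> 'a set) set"
  where "I_orb \<Omega> = the_elem (I_O1 ` \<Omega>)"

definition orbit_group :: "'a::field \<Rightarrow> 'a poly poly set monoid"
  where "orbit_group M =
    \<lparr>carrier = SL2_orbits M,
     mult = (\<lambda>\<Omega> \<Omega>'. inv_into (SL2_orbits M) I_orb (I_orb \<Omega> \<otimes>\<^bsub>fibre_group M\<^esub> I_orb \<Omega>')),
     one = inv_into (SL2_orbits M) I_orb \<one>\<^bsub>fibre_group M\<^esub>\<rparr>"

end

theory Submission
  imports Defs
begin

text \<open>
  A binary cubic whose quartic is a nonzero square \<open>q\<^sup>2\<close> is a sum \<open>l\<phi>\<^sup>3 + m\<psi>\<^sup>3\<close> of two cubes of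
  independent linear forms: the quartic is the discriminant of the Hessian, and \<open>\<phi>\<close>, \<open>\<psi>\<close> are
  the linear factors of the Hessian (\<open>cube_sum_exists\<close>). A linear substitution of determinant \<open>1\<close>
  sends \<open>\<phi>\<close> to a multiple of \<open>x\<close> and \<open>\<psi>\<close> to \<open>y\<close>, so every orbit contains a diagonal cubic
  \<open>rx\<^sup>3 + sy\<^sup>3\<close> (\<open>diagonalize\<close>). A diagonal cubic has, up to order, no decomposition into coprime
  cubes other than the evident one (\<open>diagonal_decomposition_unique\<close>); hence the invariant is well defined, is constant
  on orbits, and has the value \<open>[rs, r/s]\<close> on \<open>rx\<^sup>3 + sy\<^sup>3\<close> (\<open>I_O1_cube_sum\<close>).

  Once a square root \<open>q\<close> is chosen, one can take \<open>rs = q\<close>, and only the cube class of \<open>r/s\<close> is left.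
  Diagonal substitutions multiply \<open>r\<close> by any cube and divide \<open>s\<close> by it, and this is enough to join two
  cubics with the same invariants (\<open>orbit_eq_if_same_invariants\<close>). Every cube class occurs
  (\<open>invariant_surjective\<close>). So the orbits with quartic \<open>q\<^sup>2\<close> correspond to the fibre of the squaring
  map over \<open>q\<^sup>2\<close>, and this fibre to the group of cube classes (\<open>fibre_group_iso\<close>).

  The neutral orbit is the one with \<open>r/s\<close> a cube. This is equivalent to reducibility, since a proper
  factor yields a root of \<open>rx\<^sup>3 + sy\<^sup>3\<close> over \<open>k\<close>, that is, a cube root of \<open>-s/r\<close>
  (\<open>diagonal_irreducible_iff\<close>).
\<close>

section \<open>Linear substitutions\<close>

text \<open>
  \<^const>\<open>subst2\<close> evaluates twice after mapping coefficients: once inside each coefficient, once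
  outside. Applied at both levels, the next two lemmas make it a ring homomorphism.
\<close>

lemma poly_map_poly_add:
  assumes "h 0 = 0" "\<And>a b. h (a + b) = h a + h b"
  shows "poly (map_poly h (p + q)) x = poly (map_poly h p) x + poly (map_poly h q) x"
  by (induction p q rule: poly_induct2) (simp_all add: assms map_poly_pCons algebra_simps)

lemma poly_map_poly_mult:
  fixes h :: "'b::comm_ring_1 \<Rightarrow> 'c::comm_ring_1"
  assumes h0: "h 0 = 0" and hadd: "\<And>a b. h (a + b) = h a + h b" and hmult: "\<And>a b. h (a * b) = h a * h b"
  shows "poly (map_poly h (p * q)) x = poly (map_poly h p) x * poly (map_poly h q) x"
proof (induction p)
  case (pCons a p)
  have smult: "poly (map_poly h (smult a q)) x = h a * poly (map_poly h q) x" for a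
    by (induction q) (simp_all add: h0 hmult map_poly_pCons algebra_simps)
  show ?case
    by (simp add: poly_map_poly_add[OF h0 hadd] smult h0 map_poly_pCons pCons.IH algebra_simps)
qed simp

lemma const_0 [simp]: "const 0 = 0"
  and const_add: "const (a + b) = const a + const b"
  and const_mult: "const (a * b) = const a * const b"
  by (simp_all add: const_def)

lemma const_1 [simp]: "const 1 = 1"
  by (simp add: const_def one_pCons)

lemma const_power: "const (a ^ n) = const a ^ n"
  by (induction n) (simp_all add: const_mult)

lemma subst2_add: "subst2 (P + Q) X Y = subst2 P X Y + subst2 Q X Y"
  unfolding subst2_def
  by (intro poly_map_poly_add) (simp_all add: poly_map_poly_add const_add)

lemma subst2_mult: "subst2 (P * Q) X Y = subst2 P X Y * subst2 Q X Y"
  unfolding subst2_def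
  by (intro poly_map_poly_mult) (simp_all add: poly_map_poly_add poly_map_poly_mult const_add const_mult)

lemma subst2_const [simp]: "subst2 (const a) X Y = const a"
  and subst2_varx [simp]: "subst2 varx X Y = X"
  and subst2_vary [simp]: "subst2 vary X Y = Y"
  by (simp_all add: subst2_def const_def[of a] varx_def vary_def map_poly_pCons)

lemma subst2_0 [simp]: "subst2 0 X Y = 0"
  by (simp add: subst2_def)

lemma subst2_1 [simp]: "subst2 1 X Y = 1"
  using subst2_const[of 1 X Y] by simp

lemma subst2_power: "subst2 (P ^ n) X Y = subst2 P X Y ^ n"
  by (induction n) (simp_all add: subst2_mult)

text \<open>
  Since \<open>k[x,y]\<close> is generated by the constants and the two variables, an identity between two
  ring homomorphisms defined on it need only be checked on these generators.
\<close>

lemma binary_poly_induct [case_names const varx vary add mult]: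
  assumes const: "\<And>a. R (const a)" and varx: "R varx" and vary: "R vary"
    and add: "\<And>P Q. R P \<Longrightarrow> R Q \<Longrightarrow> R (P + Q)" and mult: "\<And>P Q. R P \<Longrightarrow> R Q \<Longrightarrow> R (P * Q)"
  shows "R P"
proof -
  have inner: "R [:c:]" for c
  proof (induction c)
    case 0
    then show ?case using const[of 0] by simp
  next
    case (pCons a c)
    have "[:pCons a c:] = const a + vary * [:c:]" by (simp add: const_def vary_def)
    then show ?case using add[OF const mult[OF vary pCons.IH]] by simp
  qed
  show ?thesis
  proof (induction P)
    case 0
    then show ?case using const[of 0] by simp
  next
    case (pCons c P)
    have "pCons c P = [:c:] + varx * P" by (simp add: varx_def)
    then show ?case using add[OF inner mult[OF varx pCons.IH]] by simp
  qed
qed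

lemma subst2_subst2: "subst2 (subst2 P X Y) U V = subst2 P (subst2 X U V) (subst2 Y U V)"
  by (induction P rule: binary_poly_induct) (simp_all add: subst2_add subst2_mult)

lemma subst2_vars: "subst2 P varx vary = P"
  by (induction P rule: binary_poly_induct) (simp_all add: subst2_add subst2_mult)

text \<open>
  The substitution \<open>x \<mapsto> \<close> first row, \<open>y \<mapsto> \<close> second row of a matrix. The action of \<open>g\<close> is the
  substitution by \<open>g\<^sup>-\<^sup>1\<close>; working with the matrix of the substitution itself keeps inverses out of
  all computations. It is a right action, which has the same orbits.
\<close>

definition linsub :: "'a::field ^ 2 ^ 2 \<Rightarrow> 'a poly poly \<Rightarrow> 'a poly poly"
  where "linsub h P = subst2 P (linform (row 1 h)) (linform (row 2 h))"

lemma linsub_add: "linsub h (P + Q) = linsub h P + linsub h Q"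
  and linsub_mult: "linsub h (P * Q) = linsub h P * linsub h Q"
  and linsub_power: "linsub h (P ^ n) = linsub h P ^ n"
  and linsub_const: "linsub h (const a) = const a"
  and linsub_1: "linsub h 1 = 1"
  by (simp_all add: linsub_def subst2_add subst2_mult subst2_power)

lemma linsub_linform: "linsub h (linform c) = linform (c v* h)"
  by (simp add: linsub_def linform_def subst2_add subst2_mult row_def vector_matrix_mult_def sum_2
      const_add const_mult algebra_simps)

lemma linsub_linsub: "linsub h (linsub k P) = linsub (k ** h) P"
proof -
  have "row i k v* h = row i (k ** h)" for i
    by (simp add: row_def vector_matrix_mult_def matrix_matrix_mult_def vec_eq_iff mult.commute)
  then show ?thesis
    using linsub_linform[of h "row 1 k"] linsub_linform[of h "row 2 k"]
    by (simp add: linsub_def subst2_subst2)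
qed

lemma linsub_id: "linsub (mat 1) P = P"
proof -
  have "linform (row 1 (mat 1 :: 'a^2^2)) = varx" "linform (row 2 (mat 1 :: 'a^2^2)) = vary"
    by (simp_all add: linform_def row_def mat_def)
  then show ?thesis by (simp add: linsub_def subst2_vars)
qed

lemma matrix_inv_inverse:
  fixes g :: "'a::field^'n^'n"
  assumes "det g \<noteq> 0"
  shows "g ** matrix_inv g = mat 1" "matrix_inv g ** g = mat 1"
proof -
  have "invertible g" using assms by (simp add: invertible_det_nz)
  then have "g ** matrix_inv g = mat 1 \<and> matrix_inv g ** g = mat 1"
    unfolding invertible_def matrix_inv_def by (rule someI_ex)
  then show "g ** matrix_inv g = mat 1" "matrix_inv g ** g = mat 1" by auto
qed

lemma inverse_matrix_SL2:
  fixes g :: "'a::field^2^2"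
  assumes "det g = 1"
  obtains h where "det h = 1" "g ** h = mat 1" "h ** g = mat 1"
proof
  show "g ** matrix_inv g = mat 1" "matrix_inv g ** g = mat 1"
    using matrix_inv_inverse[of g] assms by auto
  then show "det (matrix_inv g) = 1"
    using assms by (metis det_I det_mul mult_1)
qed

text \<open>
  Inversion permutes the matrices of determinant \<open>1\<close>, so letting the substitution matrix instead of
  its inverse run over them gives the same set.
\<close>

lemma SL2_orbit_eq: "SL2_orbit P = {linsub h P | h. det h = 1}"
proof -
  have "\<exists>g. det g = 1 \<and> linsub h P = SL2_act g P" if h: "det h = 1" for h
  proof -
    obtain g where g: "det g = 1" "g ** h = mat 1" "h ** g = mat 1"
      using inverse_matrix_SL2 h by blast
    have "matrix_inv g = h"
      using matrix_inv_inverse[of g] g by (metis matrix_mul_assoc matrix_mul_lid matrix_mul_rid zero_neq_one)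
    then show ?thesis using g(1) by (auto simp: SL2_act_def linsub_def)
  qed
  moreover have "SL2_act g P = linsub (matrix_inv g) P \<and> det (matrix_inv g) = 1" if "det g = 1" for g
    using that matrix_inv_inverse[of g] by (metis SL2_act_def linsub_def det_I det_mul mult_1 zero_neq_one)
  ultimately show ?thesis
    unfolding orbit_def SL2_def by fastforce
qed

lemma SL2_orbit_linsub:
  assumes "det h = 1"
  shows "SL2_orbit (linsub h P) = SL2_orbit P"
proof -
  obtain g where g: "det g = 1" "g ** h = mat 1" "h ** g = mat 1"
    using inverse_matrix_SL2 assms by blast
  have "\<exists>k'. linsub k P = linsub (h ** k') P \<and> det k' = 1" if "det k = 1" for k
    using that g by (intro exI[of _ "g ** k"]) (simp add: matrix_mul_assoc det_mul)
  then show ?thesis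
    unfolding SL2_orbit_eq linsub_linsub using assms by (fastforce simp: det_mul)
qed

lemma SL2_orbit_self: "P \<in> SL2_orbit P"
  using linsub_id[of P] unfolding SL2_orbit_eq by (metis (mono_tags, lifting) det_I mem_Collect_eq)

section \<open>Sums of two cubes of linear forms\<close>

lemma cubic_pCons:
  "cubic a b c d = [:[:0, 0, 0, d:], [:0, 0, 3 * c:], [:0, 3 * b:], [:a:]:]"
  by (simp add: cubic_def const_def varx_def vary_def power2_eq_square power3_eq_cube)

lemma cube_pCons:
  "const l * linform c ^ 3 = cubic (l * (c$1)^3) (l * (c$1)\<^sup>2 * c$2) (l * c$1 * (c$2)\<^sup>2) (l * (c$2)^3)"
  unfolding cubic_pCons
  by (simp add: linform_def const_def varx_def vary_def power2_eq_square power3_eq_cube algebra_simps)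

lemma coords_cubic:
  assumes "(3::'a::field) \<noteq> 0"
  shows "ca (cubic a b c d) = (a::'a)" "cb (cubic a b c d) = b"
    "cc (cubic a b c d) = c" "cd (cubic a b c d) = d"
  using assms by (simp_all add: cubic_pCons ca_def cb_def cc_def cd_def numeral_2_eq_2 numeral_3_eq_3)

lemma cubic_add: "cubic a b c d + cubic a' b' c' d' = cubic (a + a') (b + b') (c + c') (d + d')"
  by (simp add: cubic_pCons algebra_simps)

definition det2 :: "'a::field ^ 2 \<Rightarrow> 'a ^ 2 \<Rightarrow> 'a"
  where "det2 c e = c$1 * e$2 - c$2 * e$1"

definition cube_sum :: "'a::field \<Rightarrow> 'a ^ 2 \<Rightarrow> 'a \<Rightarrow> 'a ^ 2 \<Rightarrow> 'a poly poly"
  where "cube_sum l c m e = const l * linform c ^ 3 + const m * linform e ^ 3"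

lemma cube_sum_cubic:
  "cube_sum l c m e = cubic (l * (c$1)^3 + m * (e$1)^3) (l * (c$1)\<^sup>2 * c$2 + m * (e$1)\<^sup>2 * e$2)
     (l * c$1 * (c$2)\<^sup>2 + m * e$1 * (e$2)\<^sup>2) (l * (c$2)^3 + m * (e$2)^3)"
  by (simp add: cube_sum_def cube_pCons cubic_add)

lemma cube_sum_commute: "cube_sum l c m e = cube_sum m e l c"
  by (simp add: cube_sum_def add.commute)

lemma omega_cubes:
  assumes "(3::'a::field) \<noteq> 0"
  shows "omega (const (l::'a) * linform c ^ 3) (const m * linform e ^ 3) = l * m * det2 c e ^ 3"
  unfolding cube_pCons omega_def coords_cubic[OF assms] det2_def
  by algebra

text \<open>
  The quartic of a sum of two cubes is the square of the symplectic pairing of the summands. In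
  particular it vanishes when the sum degenerates, so a cubic with nonzero quartic has only
  nondegenerate decompositions.
\<close>

lemma Qn_cube_sum:
  assumes "(3::'a::field) \<noteq> 0"
  shows "Qn (cube_sum (l::'a) c m e) = (l * m * det2 c e ^ 3)\<^sup>2"
  unfolding cube_sum_cubic Qn_def coords_cubic[OF assms] det2_def
  by algebra

lemma Qn_cubic:
  assumes "(3::'a::field) \<noteq> 0"
  shows "Qn (cubic (a::'a) b c d) = a\<^sup>2 * d\<^sup>2 - 3 * b\<^sup>2 * c\<^sup>2 - 6 * a * b * c * d + 4 * b ^ 3 * d + 4 * a * c ^ 3"
  unfolding Qn_def coords_cubic[OF assms] ..

text \<open>
  The Hessian of \<open>ax\<^sup>3 + 3bx\<^sup>2y + 3cxy\<^sup>2 + dy\<^sup>3\<close> is \<open>Ax\<^sup>2 + Bxy + Cy\<^sup>2\<close> with the \<open>A, B, C\<close> below, and its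
  discriminant \<open>B\<^sup>2 - 4AC\<close> is the quartic. The Hessian of \<open>l\<phi>\<^sup>3 + m\<psi>\<^sup>3\<close> is a multiple of \<open>\<phi>\<psi>\<close>, so the
  linear forms to be found are the factors of the Hessian, which exist over \<open>k\<close> because the
  discriminant is a square. Here \<open>A \<noteq> 0\<close>, so the factors are \<open>x - ry\<close> and \<open>x - sy\<close> with \<open>r, s\<close> the
  roots of \<open>Az\<^sup>2 + Bz + C\<close>.
\<close>

lemma cube_sum_exists_leading:
  fixes a b c d q :: "'a::field"
  assumes two: "(2::'a) \<noteq> 0"
    and Q: "a\<^sup>2 * d\<^sup>2 - 3 * b\<^sup>2 * c\<^sup>2 - 6 * a * b * c * d + 4 * b ^ 3 * d + 4 * a * c ^ 3 = q\<^sup>2"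
    and q: "q \<noteq> 0" and A: "a * c - b\<^sup>2 \<noteq> 0"
  shows "\<exists>l v m w. cubic a b c d = cube_sum l v m w"
proof -
  define A B C where "A = a * c - b\<^sup>2" and "B = a * d - b * c" and "C = b * d - c\<^sup>2"
  define r s where "r = (q - B) / (2 * A)" and "s = (- q - B) / (2 * A)"
  have A0: "A \<noteq> 0" using A by (simp add: A_def)
  have disc: "B\<^sup>2 - 4 * A * C = q\<^sup>2"
    using Q unfolding A_def B_def C_def by algebra
  have "r - s = q / A"
    using two A0 by (simp add: r_def s_def field_simps)
  then have rs: "r - s \<noteq> 0" using q A0 by simp
  have "2 * A * r = q - B" "2 * A * s = - q - B"
    using two A0 by (simp_all add: r_def s_def)
  then have "2 * (A * (r + s)) = 2 * (- B)" "4 * A * (A * (r * s)) = 4 * A * C"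
    using disc by algebra+
  moreover have "4 * A \<noteq> 0" using two A0 by (metis mult_2 mult_eq_0_iff numeral_Bit0 numeral_code(2))
  ultimately have sum: "A * (r + s) = - B" and prod: "A * (r * s) = C"
    using two by (metis mult_cancel_left)+
  \<comment> \<open>The solution of \<open>l + m = a\<close>, \<open>l r + m s = - b\<close>, the equations of the two leading coefficients.
    Both sequences \<open>a, - b, c, - d\<close> and \<open>l r\<^sup>i + m s\<^sup>i\<close> obey the recursion with characteristic
    polynomial \<open>Az\<^sup>2 + Bz + C\<close>, so the other two equations follow.\<close>
  define l m where "l = - (b + a * s) / (r - s)" and "m = (b + a * r) / (r - s)"
  have l: "l * (r - s) = - (b + a * s)" and m: "m * (r - s) = b + a * r"
    using rs by (simp_all add: l_def m_def)
  have "(l + m) * (r - s) = a * (r - s)" using l m by algebra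
  then have e1: "a = l + m" using rs by simp
  have "(l * r + m * s) * (r - s) = - b * (r - s)" using l m by algebra
  then have e2: "b = - (l * r + m * s)" using rs by (metis mult_cancel_right minus_minus)
  have "A * c = A * (l * r\<^sup>2 + m * s\<^sup>2)"
  proof -
    have "A * (l * r\<^sup>2 + m * s\<^sup>2) = A * (r + s) * (l * r + m * s) - A * (r * s) * (l + m)" by algebra
    also have "\<dots> = B * b - C * a" unfolding sum prod using e1 e2 by algebra
    also have "\<dots> = A * c" unfolding A_def B_def C_def by algebra
    finally show ?thesis ..
  qed
  then have e3: "c = l * r\<^sup>2 + m * s\<^sup>2" using A0 by simp
  have "A * d = A * (- (l * r^3 + m * s^3))"
  proof -
    have "A * (- (l * r^3 + m * s^3)) = - (A * (r + s) * (l * r\<^sup>2 + m * s\<^sup>2)) + A * (r * s) * (l * r + m * s)"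
      by algebra
    also have "\<dots> = B * c - C * b" unfolding sum prod using e2 e3 by algebra
    also have "\<dots> = A * d" unfolding A_def B_def C_def by algebra
    finally show ?thesis ..
  qed
  then have e4: "d = - (l * r^3 + m * s^3)" using A0 by (metis mult_cancel_left)
  have "cubic a b c d = cube_sum l (vector [1, - r]) m (vector [1, - s])"
    unfolding cube_sum_cubic vector_2
    by (rule arg_cong4[where f = cubic]) (use e1 e2 e3 e4 in \<open>simp_all add: power2_eq_square power3_eq_cube\<close>)
  then show ?thesis by blast
qed

text \<open>
  If the Hessian has no \<open>x\<^sup>2\<close> term but a \<open>y\<^sup>2\<close> term, exchange the variables; if it has neither, the
  cubic is already diagonal. Exchanging the two summands changes the sign of the pairing, so either
  square root \<open>q\<close> of the quartic can be prescribed as its value.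
\<close>

lemma cube_sum_exists:
  fixes P :: "'a::field poly poly"
  assumes two: "(2::'a) \<noteq> 0" and three: "(3::'a) \<noteq> 0"
    and P: "P \<in> S3" and Q: "Qn P = q\<^sup>2" and q: "q \<noteq> 0"
  obtains l c m e where "P = cube_sum l c m e" "l * m * det2 c e ^ 3 = q"
proof -
  obtain a b c d where Pc: "P = cubic a b c d" using P by (auto simp: S3_def)
  have Qc: "a\<^sup>2 * d\<^sup>2 - 3 * b\<^sup>2 * c\<^sup>2 - 6 * a * b * c * d + 4 * b ^ 3 * d + 4 * a * c ^ 3 = q\<^sup>2"
    using Q by (simp add: Pc Qn_cubic[OF three])
  have "\<exists>l v m w. P = cube_sum l v m w"
  proof (cases "a * c - b\<^sup>2 = 0")
    case False
    then show ?thesis unfolding Pc using cube_sum_exists_leading[OF two Qc q] by blast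
  next
    case A: True
    show ?thesis
    proof (cases "d * b - c\<^sup>2 = 0")
      case False
      have "d\<^sup>2 * a\<^sup>2 - 3 * c\<^sup>2 * b\<^sup>2 - 6 * d * c * b * a + 4 * c ^ 3 * a + 4 * d * b ^ 3 = q\<^sup>2"
        using Qc by (simp add: algebra_simps)
      from cube_sum_exists_leading[OF two this q False]
      obtain l v m w where eq: "cubic d c b a = cube_sum l v m w" by blast
      have "cubic a b c d = cube_sum l (vector [v$2, v$1]) m (vector [w$2, w$1])"
      proof -
        note co = arg_cong[OF eq[unfolded cube_sum_cubic], of ca] arg_cong[OF eq[unfolded cube_sum_cubic], of cb]
          arg_cong[OF eq[unfolded cube_sum_cubic], of cc] arg_cong[OF eq[unfolded cube_sum_cubic], of cd]
        show ?thesis using co unfolding cube_sum_cubic coords_cubic[OF three] vector_2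
          by (simp add: algebra_simps)
      qed
      then show ?thesis unfolding Pc by blast
    next
      case C: True
      have "b = 0"
      proof (rule ccontr)
        assume b: "b \<noteq> 0"
        have "b * q\<^sup>2 = 0" "c * q\<^sup>2 = 0" using A C Qc by algebra+
        then show False using b q by simp
      qed
      then have "c = 0" using C by simp
      have "P = cube_sum a (vector [1, 0]) d (vector [0, 1])"
        unfolding Pc cube_sum_cubic vector_2 using \<open>b = 0\<close> \<open>c = 0\<close> by simp
      then show ?thesis by blast
    qed
  qed
  then obtain l v m w where d: "P = cube_sum l v m w" by blast
  have "(l * m * det2 v w ^ 3)\<^sup>2 = q\<^sup>2"
    using Q unfolding d Qn_cube_sum[OF three] .
  then consider "l * m * det2 v w ^ 3 = q" | "m * l * det2 w v ^ 3 = q"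
    unfolding power2_eq_iff det2_def by (auto simp: power3_eq_cube algebra_simps)
  then show ?thesis
    using that d cube_sum_commute by metis
qed

lemma linsub_cube_sum: "linsub h (cube_sum l c m e) = cube_sum l (c v* h) m (e v* h)"
  by (simp add: cube_sum_def linsub_add linsub_mult linsub_const linsub_power linsub_linform)

lemma det2_transform: "det2 (c v* h) (e v* h) = det2 c e * det h"
  by (simp add: det2_def det_2 vector_matrix_mult_def sum_2 algebra_simps)

text \<open>
  The inverse of the matrix with rows \<open>c\<close> and \<open>e\<close> sends the two forms to \<open>x\<close> and \<open>y\<close>; scaling its
  first column by \<open>det2 c e\<close> makes its determinant \<open>1\<close>.
\<close>

lemma diagonalizing_matrix:
  assumes "det2 c e \<noteq> 0"
  obtains h where "det h = 1" "c v* h = vector [det2 c e, 0]" "e v* h = vector [0, 1]"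
proof
  let ?h = "vector [vector [e$2, - c$2 / det2 c e], vector [- e$1, c$1 / det2 c e]] :: 'a^2^2"
  have "c$1 * e$2 - c$2 * e$1 = det2 c e" by (simp add: det2_def)
  then show "det ?h = 1" "c v* ?h = vector [det2 c e, 0]" "e v* ?h = vector [0, 1]"
    using assms
    by (simp_all add: det_2 vector_matrix_mult_def sum_2 vec_eq_iff forall_2 divide_simps)
       (simp_all add: algebra_simps)
qed

lemma cube_sum_diagonal: "cube_sum l (vector [x, 0]) m (vector [0, y]) = cubic (l * x^3) 0 0 (m * y^3)"
  by (simp add: cube_sum_cubic)

lemma diagonalize:
  assumes "det2 c e \<noteq> 0"
  obtains h where "det h = 1" "linsub h (cube_sum l c m e) = cubic (l * det2 c e ^ 3) 0 0 m"
proof -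
  obtain h where "det h = 1" "c v* h = vector [det2 c e, 0]" "e v* h = vector [0, 1]"
    using diagonalizing_matrix assms by blast
  then show ?thesis using that[of h] by (simp add: linsub_cube_sum cube_sum_diagonal)
qed

lemma cubic_eq_iff:
  assumes "(3::'a::field) \<noteq> 0"
  shows "cubic (a::'a) b c d = cubic a' b' c' d' \<longleftrightarrow> a = a' \<and> b = b' \<and> c = c' \<and> d = d'"
  using coords_cubic[OF assms] by metis

text \<open>
  The two middle coefficients of \<open>l\<phi>\<^sup>3 + m\<psi>\<^sup>3\<close> vanish. These are the two coordinates of the vector
  equation \<open>l c\<^sub>1 c\<^sub>2 c + m e\<^sub>1 e\<^sub>2 e = 0\<close>, so linear independence of \<open>c\<close> and \<open>e\<close> forces
  \<open>c\<^sub>1 c\<^sub>2 = e\<^sub>1 e\<^sub>2 = 0\<close>: each form is a multiple of a variable.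
\<close>

lemma diagonal_decomposition_unique:
  fixes l m :: "'a::field"
  assumes three: "(3::'a) \<noteq> 0" and eq: "cubic r 0 0 s = cube_sum l c m e"
    and nz: "l \<noteq> 0" "m \<noteq> 0" "det2 c e \<noteq> 0"
  shows "c$2 = 0 \<and> e$1 = 0 \<and> r = l * (c$1)^3 \<and> s = m * (e$2)^3
       \<or> c$1 = 0 \<and> e$2 = 0 \<and> r = m * (e$1)^3 \<and> s = l * (c$2)^3"
proof -
  have eqs: "r = l * (c$1)^3 + m * (e$1)^3" "l * (c$1)\<^sup>2 * c$2 + m * (e$1)\<^sup>2 * e$2 = 0"
     "l * c$1 * (c$2)\<^sup>2 + m * e$1 * (e$2)\<^sup>2 = 0" "s = l * (c$2)^3 + m * (e$2)^3"
    using eq unfolding cube_sum_cubic cubic_eq_iff[OF three] by auto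
  have "l * c$1 * c$2 * det2 c e = 0" "m * e$1 * e$2 * det2 c e = 0"
    unfolding det2_def using eqs(2,3) by algebra+
  then have "c$1 = 0 \<or> c$2 = 0" "e$1 = 0 \<or> e$2 = 0"
    using nz by auto
  then show ?thesis using eqs nz by (auto simp: det2_def)
qed

lemma linform_pCons: "linform c = [:[:0, c$2:], [:c$1:]:]"
  by (simp add: linform_def const_def varx_def vary_def)

lemma linform_not_unit:
  assumes "c \<noteq> 0"
  shows "\<not> is_unit (linform c)"
proof
  assume "is_unit (linform c)"
  then have "c$1 = 0" "is_unit [:0, c$2:]"
    by (auto simp: linform_pCons is_unit_poly_iff)
  then have "c = 0" by (auto simp: is_unit_pCons_iff vec_eq_iff forall_2)
  then show False using assms by simp
qed

text \<open>
  A divisor of \<open>y\<^sup>n\<close> does not contain \<open>x\<close>, and then it divides the coefficient \<open>1\<close> of \<open>x\<^sup>n\<close>.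
\<close>

lemma common_divisor_var_powers:
  assumes "d dvd varx ^ n" "d dvd vary ^ n"
  shows "is_unit d"
proof -
  have y: "vary ^ n = [:[:0, 1:] ^ n:]"
    unfolding vary_def by (rule poly_const_pow)
  have "degree d \<le> degree (vary ^ n :: 'a poly poly)"
    using assms(2) by (rule dvd_imp_degree_le) (simp add: y)
  then have "degree d = 0" by (simp add: y)
  then obtain f where f: "d = [:f:]" by (rule degree_eq_zeroE)
  have x: "varx = monom 1 (Suc 0)" by (simp add: varx_def monom_Suc)
  have "f dvd coeff (varx ^ n) n"
    using assms(1) unfolding f const_poly_dvd_iff by blast
  then show ?thesis by (simp add: f x monom_power is_unit_const_poly_iff)
qed

lemma is_unit_const: "a \<noteq> 0 \<Longrightarrow> is_unit (const a)"
  using const_mult[of a "inverse a"] by (auto simp: dvd_def)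

text \<open>
  Proportional forms divide each other. If the forms are independent, \<open>x\<close> and \<open>y\<close> are combinations of
  them, and a fifth power of such a combination lies in the ideal of the two cubes, because every
  term of \<open>(u + v)\<^sup>5\<close> contains \<open>u\<^sup>3\<close> or \<open>v\<^sup>3\<close>. So a common divisor of the cubes divides \<open>x\<^sup>5\<close> and \<open>y\<^sup>5\<close>.
\<close>

lemma coprime_cubes_iff:
  assumes "l \<noteq> 0" "m \<noteq> 0" "c \<noteq> 0" "e \<noteq> 0"
  shows "coprime (const l * linform c ^ 3) (const m * linform e ^ 3) \<longleftrightarrow> det2 c e \<noteq> 0"
proof
  assume coprime: "coprime (const l * linform c ^ 3) (const m * linform e ^ 3)"
  show "det2 c e \<noteq> 0"
  proof
    assume "det2 c e = 0"
    then have det: "c$1 * e$2 = c$2 * e$1" by (simp add: det2_def)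
    have "\<exists>t. e$1 = t * c$1 \<and> e$2 = t * c$2"
    proof (cases "c$1 = 0")
      case True
      then have "c$2 \<noteq> 0" using assms(3) by (auto simp: vec_eq_iff forall_2)
      then show ?thesis using True det by (intro exI[of _ "e$2 / c$2"]) simp
    next
      case False
      then show ?thesis using det by (intro exI[of _ "e$1 / c$1"]) (simp add: field_simps)
    qed
    then obtain t where "e$1 = t * c$1" "e$2 = t * c$2" by blast
    then have "linform e = const t * linform c"
      by (simp add: linform_pCons const_def)
    then have "linform c dvd const l * linform c ^ 3" "linform c dvd const m * linform e ^ 3"
      by (simp_all add: power3_eq_cube)
    then show False
      using coprime linform_not_unit[OF assms(3)] coprime_common_divisor by blast
  qed
next
  assume det: "det2 c e \<noteq> 0"
  show "coprime (const l * linform c ^ 3) (const m * linform e ^ 3)"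
  proof (rule coprimeI)
    fix d assume "d dvd const l * linform c ^ 3" "d dvd const m * linform e ^ 3"
    then have d: "d dvd linform c ^ 3" "d dvd linform e ^ 3"
      by (simp_all only: dvd_mult_unit_iff'[OF is_unit_const[OF assms(1)]] dvd_mult_unit_iff'[OF is_unit_const[OF assms(2)]])
    have comb: "d dvd (r * linform c + s * linform e) ^ 5" for r s
    proof -
      define u v where "u = r * linform c" and "v = s * linform e"
      have "d dvd u ^ 3" "d dvd v ^ 3"
        using d by (simp_all add: u_def v_def power_mult_distrib)
      moreover have "(u + v) ^ 5 = u ^ 3 * (u\<^sup>2 + 5 * u * v + 10 * v\<^sup>2) + v ^ 3 * (10 * u\<^sup>2 + 5 * u * v + v\<^sup>2)"
        by algebra
      ultimately show ?thesis unfolding u_def[symmetric] v_def[symmetric] by (metis dvd_add dvd_mult2)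
    qed
    have "const (e$2) * linform c + const (- c$2) * linform e = const (det2 c e) * varx"
      "const (- e$1) * linform c + const (c$1) * linform e = const (det2 c e) * vary"
      by (simp_all add: linform_pCons const_def varx_def vary_def det2_def algebra_simps)
    then have "d dvd (const (det2 c e) * varx) ^ 5" "d dvd (const (det2 c e) * vary) ^ 5"
      using comb by metis+
    then have "d dvd varx ^ 5" "d dvd vary ^ 5"
      using is_unit_const[of "det2 c e ^ 5"] det
      by (simp_all add: power_mult_distrib const_power[symmetric] dvd_mult_unit_iff')
    then show "is_unit d" by (rule common_divisor_var_powers)
  qed
qed


section \<open>Cube classes\<close>

lemma comm_group_kstar: "comm_group (kstar :: 'a::field monoid)"
proof (rule comm_groupI)
  fix x :: 'a assume "x \<in> carrier kstar"
  then show "\<exists>y\<in>carrier kstar. y \<otimes>\<^bsub>kstar\<^esub> x = \<one>\<^bsub>kstar\<^esub>"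
    by (intro bexI[of _ "inverse x"]) (auto simp: kstar_def)
qed (auto simp: kstar_def)

lemma inv_kstar: "a \<noteq> 0 \<Longrightarrow> inv\<^bsub>kstar\<^esub> a = inverse a"
  by (rule group.inv_equality[OF comm_group.axioms(2)[OF comm_group_kstar]]) (auto simp: kstar_def)

lemma normal_cubes: "(cubes :: 'a::field set) \<lhd> kstar"
proof (rule comm_group.subgroup_imp_normal[OF comm_group_kstar])
  show "subgroup (cubes :: 'a set) kstar"
  proof (rule group.subgroupI)
    show "group (kstar :: 'a monoid)" by (rule comm_group.axioms(2)[OF comm_group_kstar])
  next
    fix a :: 'a assume "a \<in> cubes"
    then obtain t where t: "t \<noteq> 0" "a = t ^ 3" by (auto simp: cubes_def)
    then have "inv\<^bsub>kstar\<^esub> a = inverse t ^ 3" by (simp add: inv_kstar power_inverse)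
    then show "inv\<^bsub>kstar\<^esub> a \<in> cubes" using t by (auto simp: cubes_def)
  next
    fix a b :: 'a assume "a \<in> cubes" "b \<in> cubes"
    then obtain s t where "s \<noteq> 0" "a = s ^ 3" "t \<noteq> 0" "b = t ^ 3" by (auto simp: cubes_def)
    then have "s * t \<noteq> 0 \<and> a * b = (s * t) ^ 3" by (simp add: power_mult_distrib)
    then show "a \<otimes>\<^bsub>kstar\<^esub> b \<in> cubes" by (auto simp: kstar_def cubes_def)
  next
    show "(cubes :: 'a set) \<noteq> {}" by (auto simp: cubes_def intro: exI[of _ 1])
  qed (auto simp: kstar_def cubes_def)
qed

lemma comm_group_cube_classes: "comm_group (cube_classes :: 'a::field set monoid)"
  unfolding cube_classes_def
  by (rule comm_group.abelian_FactGroup[OF comm_group_kstar])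
     (rule normal_imp_subgroup[OF normal_cubes])

lemma group_cube_classes: "group (cube_classes :: 'a::field set monoid)"
  by (rule comm_group.axioms(2)[OF comm_group_cube_classes])

lemma carrier_cube_classes: "carrier cube_classes = cube_class ` {a. a \<noteq> 0}"
  by (simp add: cube_classes_def carrier_FactGroup cube_class_def[abs_def] kstar_def)

lemma cube_class_closed: "a \<noteq> 0 \<Longrightarrow> cube_class a \<in> carrier cube_classes"
  by (simp add: carrier_cube_classes)

lemma cube_class_mult:
  assumes "a \<noteq> 0" "b \<noteq> 0"
  shows "cube_class a \<otimes>\<^bsub>cube_classes\<^esub> cube_class b = cube_class (a * b)"
  using normal.rcos_sum[OF normal_cubes, of a b] assms
  by (simp add: cube_classes_def cube_class_def kstar_def)

lemma cube_class_altdef: "cube_class a = {t ^ 3 * a | t. t \<noteq> 0}"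
  by (auto simp: cube_class_def r_coset_def cubes_def kstar_def)

lemma cube_class_eq_iff:
  assumes "a \<noteq> 0" "b \<noteq> 0"
  shows "cube_class a = cube_class b \<longleftrightarrow> (\<exists>t. t \<noteq> 0 \<and> a = t ^ 3 * b)"
proof
  assume "cube_class a = cube_class b"
  moreover have "a \<in> cube_class a"
    by (auto simp: cube_class_altdef intro: exI[of _ 1])
  ultimately show "\<exists>t. t \<noteq> 0 \<and> a = t ^ 3 * b" by (auto simp: cube_class_altdef)
next
  assume "\<exists>t. t \<noteq> 0 \<and> a = t ^ 3 * b"
  then obtain t where t: "t \<noteq> 0" "a = t ^ 3 * b" by blast
  have "\<exists>s'. s ^ 3 * a = s' ^ 3 * b \<and> s' \<noteq> 0" "\<exists>s'. s ^ 3 * b = s' ^ 3 * a \<and> s' \<noteq> 0" if "s \<noteq> 0" for s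
    using t that
    by (intro exI[of _ "s * t"], simp add: power_mult_distrib,
        intro exI[of _ "s / t"], simp add: power_divide)
  then show "cube_class a = cube_class b"
    unfolding cube_class_altdef by blast
qed

lemma cube_class_eqI: "t \<noteq> 0 \<Longrightarrow> b \<noteq> 0 \<Longrightarrow> a = t ^ 3 * b \<Longrightarrow> cube_class a = cube_class b"
  using cube_class_eq_iff[of a b] by auto

lemma cube_class_one: "\<one>\<^bsub>cube_classes\<^esub> = cube_class 1"
  by (simp add: cube_classes_def cube_class_altdef cubes_def)

lemma cube_class_inv:
  assumes "a \<noteq> 0"
  shows "inv\<^bsub>cube_classes\<^esub> (cube_class a) = cube_class (inverse a)"
  by (rule group.inv_equality[OF group_cube_classes])
     (use assms in \<open>simp_all add: cube_class_mult cube_class_one cube_class_closed\<close>)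

section \<open>The fibres of the squaring map\<close>

lemma tw_altdef: "tw l \<alpha> = {(l, \<alpha>), (- l, inv\<^bsub>cube_classes\<^esub> \<alpha>)}"
proof -
  have "tw l \<alpha> = (\<lambda>s. Z2_act s (l, \<alpha>)) ` {- 1, 1}"
    by (auto simp: tw_def orbit_def sign_img_def)
  then show ?thesis by (auto simp: Z2_act_def)
qed

lemma twisted_altdef: "twisted = {tw l \<alpha> | l \<alpha>. l \<noteq> 0 \<and> \<alpha> \<in> carrier cube_classes}"
  by (auto simp: twisted_def orbits_def tw_def kstar_def)

lemma sq_tw: "sq (tw l \<alpha>) = l\<^sup>2"
  by (simp add: sq_def tw_altdef)

lemma tw_minus:
  assumes "\<alpha> \<in> carrier cube_classes"
  shows "tw (- l) (inv\<^bsub>cube_classes\<^esub> \<alpha>) = tw l \<alpha>"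
  using group.inv_inv[OF group_cube_classes assms] by (auto simp: tw_altdef)

text \<open>
  The two members of a class have first components \<open>q\<close> and \<open>-q\<close>, which differ in characteristic
  other than \<open>2\<close>. Hence fixing a square root identifies a fibre with the cube classes.
\<close>

lemma tw_eq_iff:
  fixes q :: "'a::field"
  assumes "(2::'a) \<noteq> 0" "q \<noteq> 0"
  shows "tw q \<alpha> = tw q \<beta> \<longleftrightarrow> \<alpha> = \<beta>"
proof -
  have "q \<noteq> - q" using assms by (metis add_eq_0_iff mult_2 mult_eq_0_iff)
  then show ?thesis by (auto simp: tw_altdef doubleton_eq_iff)
qed

lemma fibre_eq:
  assumes q: "q \<noteq> 0" "q\<^sup>2 = M"
  shows "fibre M = tw q ` carrier cube_classes"
proof
  show "tw q ` carrier cube_classes \<subseteq> fibre M"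
    using q by (auto simp: fibre_def sq_tw twisted_altdef)
  show "fibre M \<subseteq> tw q ` carrier cube_classes"
  proof
    fix u assume "u \<in> fibre M"
    then obtain l \<alpha> where u: "u = tw l \<alpha>" "\<alpha> \<in> carrier cube_classes" and "l\<^sup>2 = q\<^sup>2"
      using q by (auto simp: fibre_def sq_tw twisted_altdef)
    then consider "l = q" | "l = - q" by (auto simp: power2_eq_iff)
    then show "u \<in> tw q ` carrier cube_classes"
    proof cases
      case 2
      then have "u = tw q (inv\<^bsub>cube_classes\<^esub> \<alpha>)" using u tw_minus[OF u(2), of l] by simp
      then show ?thesis using group.inv_closed[OF group_cube_classes u(2)] by simp
    qed (use u in simp)
  qed
qed

text \<open>
  Passing from \<open>q\<close> to \<open>-q\<close> inverts both cube classes, and inversion is an automorphism of an abelian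
  group; so the two square roots yield the same product.
\<close>

lemma fibre_mult:
  fixes q :: "'a::field"
  assumes two: "(2::'a) \<noteq> 0" and q: "q \<noteq> 0" "q\<^sup>2 = M"
    and \<alpha>: "\<alpha> \<in> carrier cube_classes" and \<beta>: "\<beta> \<in> carrier cube_classes"
  shows "tw q \<alpha> \<otimes>\<^bsub>fibre_group M\<^esub> tw q \<beta> = tw q (\<alpha> \<otimes>\<^bsub>cube_classes\<^esub> \<beta>)"
proof -
  interpret comm_group "cube_classes :: 'a set monoid" by (rule comm_group_cube_classes)
  have unique: "tw p (\<gamma> \<otimes>\<^bsub>cube_classes\<^esub> \<delta>) = tw q (\<alpha> \<otimes>\<^bsub>cube_classes\<^esub> \<beta>)"
    if p: "p\<^sup>2 = M" and \<gamma>: "\<gamma> \<in> carrier cube_classes" and \<delta>: "\<delta> \<in> carrier cube_classes"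
      and eq: "tw q \<alpha> = tw p \<gamma>" "tw q \<beta> = tw p \<delta>" for p \<gamma> \<delta>
  proof -
    consider "p = q" | "p = - q" using p q by (auto simp: power2_eq_iff)
    then show ?thesis
    proof cases
      case 1
      then show ?thesis using eq tw_eq_iff[OF two q(1)] by metis
    next
      case 2
      then have "tw p \<gamma> = tw q (inv\<^bsub>cube_classes\<^esub> \<gamma>)" "tw p \<delta> = tw q (inv\<^bsub>cube_classes\<^esub> \<delta>)"
        using tw_minus[OF \<gamma>, of p] tw_minus[OF \<delta>, of p] by simp_all
      then have "\<alpha> = inv\<^bsub>cube_classes\<^esub> \<gamma>" "\<beta> = inv\<^bsub>cube_classes\<^esub> \<delta>"
        using eq tw_eq_iff[OF two q(1)] by metis+
      then have "inv\<^bsub>cube_classes\<^esub> (\<gamma> \<otimes>\<^bsub>cube_classes\<^esub> \<delta>) = \<alpha> \<otimes>\<^bsub>cube_classes\<^esub> \<beta>"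
        using inv_mult \<gamma> \<delta> by simp
      then show ?thesis
        using tw_minus[OF m_closed[OF \<gamma> \<delta>], of p] 2 by simp
    qed
  qed
  show ?thesis
    unfolding fibre_group_def monoid.simps
  proof (rule the_equality)
    show "\<exists>p \<gamma> \<delta>. p\<^sup>2 = M \<and> \<gamma> \<in> carrier cube_classes \<and> \<delta> \<in> carrier cube_classes \<and>
      tw q \<alpha> = tw p \<gamma> \<and> tw q \<beta> = tw p \<delta> \<and>
      tw q (\<alpha> \<otimes>\<^bsub>cube_classes\<^esub> \<beta>) = tw p (\<gamma> \<otimes>\<^bsub>cube_classes\<^esub> \<delta>)"
      using q \<alpha> \<beta> by blast
  qed (use unique in blast)
qed

lemma fibre_one:
  assumes q: "q\<^sup>2 = M"
  shows "\<one>\<^bsub>fibre_group M\<^esub> = tw q \<one>\<^bsub>cube_classes\<^esub>"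
  unfolding fibre_group_def monoid.simps
proof (rule the_equality)
  show "\<exists>p. p\<^sup>2 = M \<and> tw q \<one>\<^bsub>cube_classes\<^esub> = tw p \<one>\<^bsub>cube_classes\<^esub>"
    using q by (intro exI[of _ q] conjI refl)
next
  fix e assume "\<exists>p. p\<^sup>2 = M \<and> e = tw p \<one>\<^bsub>cube_classes\<^esub>"
  then obtain p where p: "p\<^sup>2 = q\<^sup>2" "e = tw p \<one>\<^bsub>cube_classes\<^esub>" unfolding q by (elim exE conjE)
  then consider "p = q" | "p = - q" by (auto simp: power2_eq_iff)
  then show "e = tw q \<one>\<^bsub>cube_classes\<^esub>"
  proof cases
    case 2
    have "tw (- q) (inv\<^bsub>cube_classes\<^esub> \<one>\<^bsub>cube_classes\<^esub>) = tw q \<one>\<^bsub>cube_classes\<^esub>"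
      by (rule tw_minus) (rule group.is_monoid[OF group_cube_classes, THEN monoid.one_closed])
    then show ?thesis
      using p(2) 2 by (simp add: monoid.inv_one[OF group.is_monoid[OF group_cube_classes]])
  qed (use p in simp)
qed

text \<open>
  Both the group on a fibre and the group on the orbits are given on records that only carry a
  product and a neutral element; their group laws are inherited along a bijection.
\<close>

lemma group_transport:
  assumes G: "group G" and bij: "bij_betw f (carrier G) (carrier H)"
    and mult: "\<And>x y. x \<in> carrier G \<Longrightarrow> y \<in> carrier G \<Longrightarrow> f (x \<otimes>\<^bsub>G\<^esub> y) = f x \<otimes>\<^bsub>H\<^esub> f y"
    and one: "f \<one>\<^bsub>G\<^esub> = \<one>\<^bsub>H\<^esub>"
  shows "group H" "f \<in> iso G H"
proof -
  show iso: "f \<in> iso G H"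
    using bij mult by (auto simp: iso_def hom_def bij_betw_def)
  show "group H"
    using group.iso_imp_img_group[OF G iso] one by simp
qed

lemma fibre_group_iso:
  fixes q :: "'a::field"
  assumes two: "(2::'a) \<noteq> 0" and q: "q \<noteq> 0" "q\<^sup>2 = M"
  shows "group (fibre_group M)" "tw q \<in> iso cube_classes (fibre_group M)"
proof -
  have bij: "bij_betw (tw q) (carrier cube_classes) (carrier (fibre_group M))"
    using tw_eq_iff[OF two q(1)] fibre_eq[OF q]
    by (auto simp: bij_betw_def inj_on_def fibre_group_def)
  show "group (fibre_group M)"
    by (rule group_transport(1)[OF group_cube_classes bij])
       (simp_all only: fibre_mult[OF two q] fibre_one[OF q(2)])
  show "tw q \<in> iso cube_classes (fibre_group M)"
    by (rule group_transport(2)[OF group_cube_classes bij])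
       (simp_all only: fibre_mult[OF two q] fibre_one[OF q(2)])
qed

section \<open>The invariant of a sum of two cubes\<close>

text \<open>
  Comparing a nonzero coefficient \<open>l c\<^sub>i\<^sup>3\<close> in two representations of the same cubic shows that the
  scalars differ by a cube.
\<close>

lemma I_T_cube:
  assumes three: "(3::'a::field) \<noteq> 0" and "(l::'a) \<noteq> 0" "c \<noteq> 0"
  shows "I_T (const l * linform c ^ 3) = cube_class l"
  unfolding I_T_def
proof (rule the_equality)
  fix \<alpha> assume "\<exists>l' c'. l' \<noteq> 0 \<and> c' \<noteq> 0 \<and> const l * linform c ^ 3 = const l' * linform c' ^ 3 \<and> \<alpha> = cube_class l'"
  then obtain l' c' where l': "l' \<noteq> 0" "const l * linform c ^ 3 = const l' * linform c' ^ 3" "\<alpha> = cube_class l'"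
    by blast
  have "l * (c$1)^3 = l' * (c'$1)^3" "l * (c$2)^3 = l' * (c'$2)^3"
    using l'(2) unfolding cube_pCons cubic_eq_iff[OF three] by auto
  moreover obtain i where i: "i = 1 \<or> i = 2" "c$i \<noteq> 0"
    using assms(3) by (auto simp: vec_eq_iff forall_2)
  ultimately have eq: "l' * (c'$i)^3 = l * (c$i)^3" by auto
  then have "c'$i \<noteq> 0" using i assms by auto
  then have "l' = (c$i / c'$i)^3 * l \<and> c$i / c'$i \<noteq> 0"
    using i eq by (simp add: power_divide field_simps)
  then show "\<alpha> = cube_class l"
    using l' assms by (subst l'(3), subst cube_class_eq_iff) blast+
qed (use assms in blast)

lemma det2_nonzero_imp: "det2 c e \<noteq> 0 \<Longrightarrow> c \<noteq> 0 \<and> e \<noteq> 0"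
  by (auto simp: det2_def)

text \<open>
  The decompositions in the definition of \<^const>\<open>I_O1\<close>, in coordinates: coprimality is a nonzero
  determinant, the pairing is the product of the scalars with the cubed determinant, and the cube
  class is that of the quotient of the scalars.
\<close>

lemma decomposition_iff:
  fixes P :: "'a::field poly poly"
  assumes three: "(3::'a) \<noteq> 0"
  shows "(\<exists>T1 T2. T1 \<in> Tset \<and> T2 \<in> Tset \<and> coprime T1 T2 \<and> P = T1 + T2 \<and>
           u = tw (omega T1 T2) (I_T T1 \<otimes>\<^bsub>cube_classes\<^esub> inv\<^bsub>cube_classes\<^esub> (I_T T2)))
     \<longleftrightarrow> (\<exists>l c m e. l \<noteq> 0 \<and> m \<noteq> 0 \<and> det2 c e \<noteq> 0 \<and> P = cube_sum l c m e \<and>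
           u = tw (l * m * det2 c e ^ 3) (cube_class (l / m)))"
    (is "?lhs \<longleftrightarrow> ?rhs")
proof -
  have quot: "I_T (const l * linform c ^ 3) \<otimes>\<^bsub>cube_classes\<^esub> inv\<^bsub>cube_classes\<^esub> (I_T (const m * linform e ^ 3))
      = cube_class (l / m)" if "l \<noteq> 0" "m \<noteq> 0" "c \<noteq> 0" "e \<noteq> 0" for l m :: 'a and c e
    using that by (simp add: I_T_cube[OF three] cube_class_inv cube_class_mult divide_inverse)
  show ?thesis
  proof
    assume ?lhs
    then obtain l c m e where "l \<noteq> 0" "c \<noteq> 0" "m \<noteq> 0" "e \<noteq> 0"
      and "coprime (const l * linform c ^ 3) (const m * linform e ^ 3)"
      and "P = const l * linform c ^ 3 + const m * linform e ^ 3"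
      and "u = tw (omega (const l * linform c ^ 3) (const m * linform e ^ 3))
         (I_T (const l * linform c ^ 3) \<otimes>\<^bsub>cube_classes\<^esub> inv\<^bsub>cube_classes\<^esub> (I_T (const m * linform e ^ 3)))"
      by (auto simp: Tset_def)
    then show ?rhs
      unfolding cube_sum_def by (metis coprime_cubes_iff quot omega_cubes[OF three])
  next
    assume ?rhs
    then obtain l c m e where *: "l \<noteq> 0" "m \<noteq> 0" "det2 c e \<noteq> 0" "P = cube_sum l c m e"
      "u = tw (l * m * det2 c e ^ 3) (cube_class (l / m))" by blast
    then have ce: "c \<noteq> 0" "e \<noteq> 0" using det2_nonzero_imp by auto
    have "const l * linform c ^ 3 \<in> Tset" "const m * linform e ^ 3 \<in> Tset"
      using * ce by (auto simp: Tset_def)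
    then show ?lhs
      using * ce coprime_cubes_iff[of l m c e]
      by (intro exI[of _ "const l * linform c ^ 3"] exI[of _ "const m * linform e ^ 3"])
         (simp add: quot omega_cubes[OF three] cube_sum_def)
  qed
qed

lemma cube_sum_in_O1:
  assumes "(3::'a::field) \<noteq> 0" "(l::'a) \<noteq> 0" "m \<noteq> 0" "det2 c e \<noteq> 0"
  shows "cube_sum l c m e \<in> O1"
proof -
  have "cube_sum l c m e \<in> S3"
    unfolding cube_sum_cubic S3_def by blast
  then show ?thesis
    using assms(2-4) Qn_cube_sum[OF assms(1), of l c m e] unfolding O1_def nonzero_squares_def
    by (simp, intro exI[of _ "l * m * det2 c e ^ 3"], simp)
qed

text \<open>
  The value of the invariant does not depend on the decomposition: after diagonalizing one of two
  decompositions, the other one consists of the same two summands, in the same or in the opposite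
  order. The opposite order negates the pairing and inverts the cube class, which is the
  identification made in the twisted product.
\<close>

lemma I_O1_cube_sum:
  assumes three: "(3::'a::field) \<noteq> 0" and nz: "(l::'a) \<noteq> 0" "m \<noteq> 0" "det2 c e \<noteq> 0"
  shows "I_O1 (cube_sum l c m e) = tw (l * m * det2 c e ^ 3) (cube_class (l / m))"
proof -
  let ?D = "det2 c e"
  obtain h where h: "det h = 1" "linsub h (cube_sum l c m e) = cubic (l * ?D ^ 3) 0 0 m"
    using diagonalize nz(3) by blast
  have unique: "tw (l' * m' * det2 c' e' ^ 3) (cube_class (l' / m')) = tw (l * m * ?D ^ 3) (cube_class (l / m))"
    if nz': "l' \<noteq> 0" "m' \<noteq> 0" "det2 c' e' \<noteq> 0" and eq: "cube_sum l c m e = cube_sum l' c' m' e'" for l' c' m' e'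
  proof -
    define v w where "v = c' v* h" and "w = e' v* h"
    have det: "det2 c' e' = det2 v w" by (simp add: v_def w_def det2_transform h)
    have "cubic (l * ?D ^ 3) 0 0 m = cube_sum l' v m' w"
      using h(2) by (simp add: eq linsub_cube_sum v_def w_def)
    from diagonal_decomposition_unique[OF three this nz'(1,2)] nz'(3) det
    consider "v$2 = 0" "w$1 = 0" "l * ?D ^ 3 = l' * (v$1)^3" "m = m' * (w$2)^3"
      | "v$1 = 0" "w$2 = 0" "l * ?D ^ 3 = m' * (w$1)^3" "m = l' * (v$2)^3" by auto
    then show ?thesis
    proof cases
      case 1
      then have dvw: "det2 v w = v$1 * w$2" by (simp add: det2_def)
      have vw: "v$1 \<noteq> 0" "w$2 \<noteq> 0" using nz'(3) unfolding det dvw by auto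
      have "l' / m' = (?D * w$2 / v$1)^3 * (l / m) \<and> ?D * w$2 / v$1 \<noteq> 0"
        using 1 vw nz nz' by (simp add: power_mult_distrib power_divide field_simps)
      then have "cube_class (l' / m') = cube_class (l / m)"
        using nz by (intro cube_class_eqI[of "?D * w$2 / v$1"]) auto
      moreover have "l' * m' * det2 c' e' ^ 3 = l * m * ?D ^ 3"
        using 1(3,4) unfolding det dvw by algebra
      ultimately show ?thesis by simp
    next
      case 2
      then have dvw: "det2 v w = - (v$2 * w$1)" by (simp add: det2_def)
      have vw: "v$2 \<noteq> 0" "w$1 \<noteq> 0" using nz'(3) unfolding det dvw by auto
      have "l' / m' = (w$1 / (v$2 * ?D))^3 * (m / l) \<and> w$1 / (v$2 * ?D) \<noteq> 0"
        using 2 vw nz nz' by (simp add: power_mult_distrib power_divide field_simps)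
      then have "cube_class (l' / m') = cube_class (m / l)"
        using nz by (intro cube_class_eqI[of "w$1 / (v$2 * ?D)"]) auto
      also have "\<dots> = inv\<^bsub>cube_classes\<^esub> (cube_class (l / m))"
        using nz by (simp add: cube_class_inv)
      moreover have "l' * m' * det2 c' e' ^ 3 = - (l * m * ?D ^ 3)"
        using 2(3,4) unfolding det dvw by algebra
      ultimately show ?thesis
        using nz by (simp add: tw_minus cube_class_closed)
    qed
  qed
  show ?thesis
    unfolding I_O1_def restrict_apply if_P[OF cube_sum_in_O1[OF three nz]] decomposition_iff[OF three]
  proof (rule the_equality)
    show "\<exists>l' c' m' e'. l' \<noteq> 0 \<and> m' \<noteq> 0 \<and> det2 c' e' \<noteq> 0 \<and> cube_sum l c m e = cube_sum l' c' m' e' \<and>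
       tw (l * m * ?D ^ 3) (cube_class (l / m)) = tw (l' * m' * det2 c' e' ^ 3) (cube_class (l' / m'))"
      using nz by blast
  qed (use unique in blast)
qed


section \<open>Reducibility\<close>

lemma irreducible_linsub_iff:
  assumes "det h = 1"
  shows "irreducible (linsub h P) \<longleftrightarrow> irreducible P"
proof -
  have unit: "is_unit (linsub h P)" if "is_unit P" for h :: "'a^2^2" and P
    using that unfolding dvd_def by (metis linsub_1 linsub_mult)
  have imp: "irreducible P" if irr: "irreducible (linsub h P)" and gh: "linsub g (linsub h P) = P"
      "\<And>Q. linsub g (linsub h Q) = Q" for h g :: "'a^2^2" and P
  proof (rule irreducibleI)
    show "P \<noteq> 0" using irr linsub_def[of h 0] by auto
    show "\<not> is_unit P" using irr unit by (auto simp: irreducible_def)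
  next
    fix a b assume "P = a * b"
    then have "is_unit (linsub h a) \<or> is_unit (linsub h b)"
      using irreducibleD[OF irr] by (simp add: linsub_mult)
    then show "is_unit a \<or> is_unit b" using unit gh(2) by metis
  qed
  obtain g where "g ** h = mat 1" "h ** g = mat 1"
    using inverse_matrix_SL2[OF assms] by metis
  then have inv: "linsub g (linsub h Q) = Q" "linsub h (linsub g Q) = Q" for Q
    by (simp_all add: linsub_linsub linsub_id)
  show ?thesis using imp[of h P g] imp[of g "linsub h P" h] inv by auto
qed

text \<open>
  If \<open>r = t\<^sup>3s\<close>, then \<open>tx + y\<close> is a factor. Conversely, the leading coefficient in \<open>x\<close> is a unit of
  \<open>k[y]\<close>, so in a proper factorization one factor is linear in \<open>x\<close> with constant leading coefficient
  and the cubic has a root \<open>x = f(y)\<close>. At \<open>y = 1\<close> this says \<open>r f(1)\<^sup>3 + s = 0\<close>.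
\<close>

lemma diagonal_irreducible_iff:
  fixes r s :: "'a::field"
  assumes r: "r \<noteq> 0" and s: "s \<noteq> 0"
  shows "irreducible (cubic r 0 0 s) \<longleftrightarrow> \<not> (\<exists>t. r = t ^ 3 * s)"
proof
  assume irr: "irreducible (cubic r 0 0 s)"
  show "\<not> (\<exists>t. r = t ^ 3 * s)"
  proof
    assume "\<exists>t. r = t ^ 3 * s"
    then obtain t where t: "r = t ^ 3 * s" by blast
    have "cubic r 0 0 s = [:[:0, 1:], [:t:]:] * [:[:0, 0, s:], [:0, - (t * s):], [:t\<^sup>2 * s:]:]"
      unfolding cubic_pCons t by (simp add: power2_eq_square power3_eq_cube)
    from irreducibleD[OF irr this] show False
      using r t s by (auto simp: is_unit_poly_iff)
  qed
next
  assume nc: "\<not> (\<exists>t. r = t ^ 3 * s)"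
  let ?P = "cubic r 0 0 s"
  have deg: "degree ?P = 3" "lead_coeff ?P = [:r:]" and P0: "?P \<noteq> 0"
    using r by (simp_all add: cubic_pCons)
  have no_linear: False if eq: "?P = a * b" and lin: "degree a = 1" and lead: "is_unit (lead_coeff a)" for a b
  proof -
    obtain f k where a: "a = [:f, k:]" using lin degree1_coeffs by blast
    moreover from this have "k \<noteq> 0" using lin by auto
    ultimately obtain u where u: "k = [:u:]" "u \<noteq> 0"
      using lead
      by (fastforce simp: is_unit_poly_iff)
    define z where "z = poly (smult (- 1 / u) f) 1"
    have "poly a (smult (- 1 / u) f) = 0" using u by (simp add: a)
    then have "poly (poly ?P (smult (- 1 / u) f)) 1 = 0" by (simp add: eq)
    then have "r * z ^ 3 + s = 0"
      by (simp add: cubic_pCons z_def power3_eq_cube algebra_simps)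
    then have "s = - (r * z ^ 3)" by (simp add: eq_neg_iff_add_eq_0 add.commute)
    moreover from this have "z \<noteq> 0" using s by auto
    ultimately have "r = (- 1 / z) ^ 3 * s" by (simp add: power_divide)
    then show False using nc by blast
  qed
  show "irreducible ?P"
  proof (rule irreducibleI)
    show "\<not> is_unit ?P"
      using deg(1) by (auto simp: is_unit_poly_iff)
    fix a b assume eq: "?P = a * b"
    then have nz: "a \<noteq> 0" "b \<noteq> 0" using P0 by auto
    have "is_unit (lead_coeff a * lead_coeff b)"
      using deg(2) r unfolding eq lead_coeff_mult by (simp add: is_unit_const_poly_iff dvd_field_iff)
    then have lead: "is_unit (lead_coeff a)" "is_unit (lead_coeff b)"
      by (simp_all add: is_unit_mult_iff)
    have "degree a + degree b = 3" using deg(1) nz by (simp add: eq degree_mult_eq)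
    then consider "degree a = 0" | "degree b = 0" | "degree a = 1" | "degree b = 1" by linarith
    then show "is_unit a \<or> is_unit b"
    proof cases
      case 1
      then have "a = [:lead_coeff a:]" by (metis degree_eq_zeroE lead_coeff_pCons(2) lead_coeff_pCons)
      then show ?thesis using lead is_unit_const_poly_iff by metis
    next
      case 2
      then have "b = [:lead_coeff b:]" by (metis degree_eq_zeroE lead_coeff_pCons(2) lead_coeff_pCons)
      then show ?thesis using lead is_unit_const_poly_iff by metis
    next
      case 3
      then show ?thesis using no_linear[OF eq] lead by blast
    next
      case 4
      then show ?thesis using no_linear[of b a] eq lead by (auto simp: mult.commute)
    qed
  qed (fact P0)
qed

lemma cube_sum_reducible_iff:
  assumes nz: "l \<noteq> 0" "m \<noteq> 0" "det2 c e \<noteq> 0"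
  shows "\<not> irreducible (cube_sum l c m e) \<longleftrightarrow> cube_class (l / m) = \<one>\<^bsub>cube_classes\<^esub>"
proof -
  obtain h where h: "det h = 1" "linsub h (cube_sum l c m e) = cubic (l * det2 c e ^ 3) 0 0 m"
    using diagonalize nz(3) by blast
  have "\<not> irreducible (cube_sum l c m e) \<longleftrightarrow> (\<exists>t. l * det2 c e ^ 3 = t ^ 3 * m)"
    using irreducible_linsub_iff[OF h(1), of "cube_sum l c m e"]
      diagonal_irreducible_iff[of "l * det2 c e ^ 3" m] nz
    unfolding h(2) by (metis no_zero_divisors power_not_zero)
  also have "\<dots> \<longleftrightarrow> (\<exists>t. t \<noteq> 0 \<and> l / m = t ^ 3 * 1)"
  proof
    assume "\<exists>t. l * det2 c e ^ 3 = t ^ 3 * m"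
    then obtain t where t: "l * det2 c e ^ 3 = t ^ 3 * m" by blast
    then have "t \<noteq> 0" using nz by auto
    then show "\<exists>t. t \<noteq> 0 \<and> l / m = t ^ 3 * 1"
      using t nz by (intro exI[of _ "t / det2 c e"]) (simp add: power_divide field_simps)
  next
    assume "\<exists>t. t \<noteq> 0 \<and> l / m = t ^ 3 * 1"
    then obtain t where t: "l / m = t ^ 3" by auto
    then show "\<exists>t. l * det2 c e ^ 3 = t ^ 3 * m"
      using nz by (intro exI[of _ "t * det2 c e"]) (simp add: power_mult_distrib field_simps)
  qed
  also have "\<dots> \<longleftrightarrow> cube_class (l / m) = \<one>\<^bsub>cube_classes\<^esub>"
    using nz by (simp add: cube_class_one cube_class_eq_iff)
  finally show ?thesis .
qed

section \<open>Orbits\<close>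

lemma OM_subset_O1: "M \<in> nonzero_squares \<Longrightarrow> OM M \<subseteq> O1"
  by (auto simp: OM_def O1_def)

lemma OM_normal_form:
  fixes q :: "'a::field"
  assumes two: "(2::'a) \<noteq> 0" and three: "(3::'a) \<noteq> 0" and q: "q \<noteq> 0" and P: "P \<in> OM (q\<^sup>2)"
  obtains l c m e where "P = cube_sum l c m e" "l \<noteq> 0" "m \<noteq> 0" "det2 c e \<noteq> 0"
    "l * m * det2 c e ^ 3 = q" "I_O1 P = tw q (cube_class (l / m))"
proof -
  have "P \<in> S3" "Qn P = q\<^sup>2" using P by (auto simp: OM_def)
  from cube_sum_exists[OF two three this q] obtain l c m e
    where P: "P = cube_sum l c m e" "l * m * det2 c e ^ 3 = q" .
  then have nz: "l \<noteq> 0" "m \<noteq> 0" "det2 c e \<noteq> 0" using q by auto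
  from I_O1_cube_sum[OF three nz] have "I_O1 P = tw q (cube_class (l / m))"
    by (simp add: P)
  then show ?thesis using that P nz by blast
qed

lemma O1_normal_form:
  fixes P :: "'a::field poly poly"
  assumes two: "(2::'a) \<noteq> 0" and three: "(3::'a) \<noteq> 0" and P: "P \<in> O1"
  obtains l c m e where "P = cube_sum l c m e" "l \<noteq> 0" "m \<noteq> 0" "det2 c e \<noteq> 0"
proof -
  obtain q where "q \<noteq> 0" "P \<in> OM (q\<^sup>2)"
    using P by (auto simp: O1_def OM_def nonzero_squares_def)
  then show ?thesis using OM_normal_form[OF two three] that by metis
qed

lemma I_O1_linsub:
  fixes P :: "'a::field poly poly"
  assumes two: "(2::'a) \<noteq> 0" and three: "(3::'a) \<noteq> 0" and P: "P \<in> O1" and h: "det h = 1"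
  shows "I_O1 (linsub h P) = I_O1 P"
proof -
  from O1_normal_form[OF two three P] obtain l c m e
    where "P = cube_sum l c m e" "l \<noteq> 0" "m \<noteq> 0" "det2 c e \<noteq> 0" .
  then show ?thesis
    using h by (simp add: linsub_cube_sum I_O1_cube_sum[OF three] det2_transform)
qed

lemma I_orb_orbit:
  fixes P :: "'a::field poly poly"
  assumes two: "(2::'a) \<noteq> 0" and three: "(3::'a) \<noteq> 0" and P: "P \<in> O1"
  shows "I_orb (SL2_orbit P) = I_O1 P"
proof -
  have "I_O1 ` SL2_orbit P = {I_O1 P}"
    using SL2_orbit_self[of P] I_O1_linsub[OF two three P] unfolding SL2_orbit_eq by blast
  then show ?thesis by (simp add: I_orb_def)
qed

text \<open>
  The substitution \<open>x \<mapsto> wx\<close>, \<open>y \<mapsto> y/w\<close>.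
\<close>

lemma diagonal_orbit_scale:
  assumes "w \<noteq> 0"
  shows "SL2_orbit (cubic (w ^ 3 * r) 0 0 s) = SL2_orbit (cubic r 0 0 (w ^ 3 * s))"
proof -
  let ?h = "vector [vector [w, 0], vector [0, 1 / w]] :: 'a^2^2"
  have vec: "vector [1, 0] v* ?h = vector [w, 0]" "vector [0, 1] v* ?h = vector [0, 1 / w]"
    by (simp_all add: vector_matrix_mult_def sum_2 vec_eq_iff forall_2)
  then have "linsub ?h (cube_sum r (vector [1, 0]) (w ^ 3 * s) (vector [0, 1])) = cubic (w ^ 3 * r) 0 0 s"
    using assms unfolding linsub_cube_sum vec by (simp add: cube_sum_diagonal power_divide mult.commute)
  then have "linsub ?h (cubic r 0 0 (w ^ 3 * s)) = cubic (w ^ 3 * r) 0 0 s"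
    by (simp add: cube_sum_diagonal)
  moreover have "det ?h = 1" using assms by (simp add: det_2)
  ultimately show ?thesis using SL2_orbit_linsub by metis
qed

text \<open>
  Diagonalize both cubics, to \<open>ax\<^sup>3 + my\<^sup>3\<close> and \<open>a'x\<^sup>3 + m'y\<^sup>3\<close>. Then \<open>am = a'm'\<close>, and \<open>a/m\<close> and \<open>a'/m'\<close>
  differ by a cube \<open>s\<^sup>3\<close>; multiplying, \<open>(a/a')\<^sup>2 = s\<^sup>3\<close>. An element whose square is a cube is itself a
  cube, here \<open>a/a' = (a/(a's))\<^sup>3\<close>, and a diagonal substitution carries one cubic to the other.
\<close>

lemma orbit_eq_if_same_invariants:
  assumes nz: "l \<noteq> 0" "m \<noteq> 0" "det2 c e \<noteq> 0" and nz': "l' \<noteq> 0" "m' \<noteq> 0" "det2 c' e' \<noteq> 0"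
    and prod: "l * m * det2 c e ^ 3 = l' * m' * det2 c' e' ^ 3"
    and quot: "cube_class (l / m) = cube_class (l' / m')"
  shows "SL2_orbit (cube_sum l c m e) = SL2_orbit (cube_sum l' c' m' e')"
proof -
  define a a' where "a = l * det2 c e ^ 3" and "a' = l' * det2 c' e' ^ 3"
  have a0: "a \<noteq> 0" "a' \<noteq> 0" using nz nz' by (simp_all add: a_def a'_def)
  have am: "a * m = a' * m'" using prod by (simp add: a_def a'_def mult_ac)
  obtain t where t: "t \<noteq> 0" "l / m = t ^ 3 * (l' / m')"
    using quot nz nz' by (auto simp: cube_class_eq_iff)
  define s where "s = t * det2 c e / det2 c' e'"
  have s0: "s \<noteq> 0" using t nz nz' by (simp add: s_def)
  have "a / m = s ^ 3 * (a' / m')"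
    using t nz nz' by (simp add: a_def a'_def s_def power_mult_distrib power_divide field_simps)
  then have "(a / m) * (a * m) = s ^ 3 * (a' / m') * (a' * m')" using am by simp
  then have sq: "a ^ 2 = s ^ 3 * a' ^ 2" using nz(2) nz'(2) by (simp add: power2_eq_square)
  define w where "w = a / (a' * s)"
  have w0: "w \<noteq> 0" using a0 s0 by (simp add: w_def)
  have "w ^ 3 * a' * (s ^ 3 * a' ^ 2) = a * a ^ 2"
    using a0 s0 by (simp add: w_def power_divide power_mult_distrib power2_eq_square power3_eq_cube)
  then have a: "a = w ^ 3 * a'" using a0 unfolding sq[symmetric] by simp
  have m': "m' = w ^ 3 * m" using am a0 by (simp add: a)
  obtain h where h: "det h = 1" "linsub h (cube_sum l c m e) = cubic a 0 0 m"
    using diagonalize nz(3) unfolding a_def by blast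
  obtain h' where h': "det h' = 1" "linsub h' (cube_sum l' c' m' e') = cubic a' 0 0 m'"
    using diagonalize nz'(3) unfolding a'_def by blast
  have "SL2_orbit (cubic a 0 0 m) = SL2_orbit (cubic a' 0 0 m')"
    unfolding a m' using w0 by (rule diagonal_orbit_scale)
  then show ?thesis
    using SL2_orbit_linsub[OF h(1), of "cube_sum l c m e"] SL2_orbit_linsub[OF h'(1), of "cube_sum l' c' m' e'"]
    unfolding h(2) h'(2) by simp
qed

text \<open>
  The cubic \<open>lx\<^sup>3 + my\<^sup>3\<close> with \<open>lm = q\<close> has second invariant \<open>l/m = l\<^sup>2/q\<close>, and \<open>l = (qa)\<^sup>2\<close> makes this
  \<open>(qa)\<^sup>3a\<close>.
\<close>

lemma invariant_surjective:
  fixes q :: "'a::field"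
  assumes three: "(3::'a) \<noteq> 0" and q: "q \<noteq> 0" and a: "a \<noteq> 0"
  shows "\<exists>P\<in>OM (q\<^sup>2). I_O1 P = tw q (cube_class a)"
proof -
  let ?l = "(q * a)\<^sup>2" and ?v = "vector [1, 0] :: 'a^2" and ?w = "vector [0, 1] :: 'a^2"
  let ?m = "q / ?l"
  have nz: "?l \<noteq> 0" "?m \<noteq> 0" and det: "det2 ?v ?w = 1" using q a by (simp_all add: det2_def)
  have "I_O1 (cube_sum ?l ?v ?m ?w) = tw q (cube_class (?l / ?m))"
    using I_O1_cube_sum[OF three nz, of ?v ?w] q a det by simp
  also have "cube_class (?l / ?m) = cube_class a"
    using q a by (intro cube_class_eqI[of "q * a"]) (simp_all add: power2_eq_square power3_eq_cube field_simps)
  finally have "I_O1 (cube_sum ?l ?v ?m ?w) = tw q (cube_class a)" .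
  moreover have "cube_sum ?l ?v ?m ?w \<in> OM (q\<^sup>2)"
    using cube_sum_in_O1[OF three nz, of ?v ?w] Qn_cube_sum[OF three, of ?l ?v ?m ?w] q a det
    by (simp add: OM_def O1_def)
  ultimately show ?thesis by blast
qed

lemma I_orb_bij:
  fixes q :: "'a::field"
  assumes two: "(2::'a) \<noteq> 0" and three: "(3::'a) \<noteq> 0" and q: "q \<noteq> 0"
  shows "bij_betw I_orb (SL2_orbits (q\<^sup>2)) (fibre (q\<^sup>2))"
proof -
  have O1: "P \<in> O1" if "P \<in> OM (q\<^sup>2)" for P
    using that q by (auto simp: OM_def O1_def nonzero_squares_def)
  have I_orb: "I_orb (SL2_orbit P) = I_O1 P" if "P \<in> OM (q\<^sup>2)" for P
    by (rule I_orb_orbit[OF two three O1[OF that]])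
  have fibre: "fibre (q\<^sup>2) = tw q ` cube_class ` {a. a \<noteq> 0}"
    using fibre_eq[OF q refl] by (simp add: carrier_cube_classes)
  have inj: "SL2_orbit P = SL2_orbit P'" if P: "P \<in> OM (q\<^sup>2)" and P': "P' \<in> OM (q\<^sup>2)"
    and eq: "I_O1 P = I_O1 P'" for P P'
  proof -
    from OM_normal_form[OF two three q P] obtain l c m e
      where 1: "P = cube_sum l c m e" "l \<noteq> 0" "m \<noteq> 0" "det2 c e \<noteq> 0"
        "l * m * det2 c e ^ 3 = q" "I_O1 P = tw q (cube_class (l / m))" .
    from OM_normal_form[OF two three q P'] obtain l' c' m' e'
      where 2: "P' = cube_sum l' c' m' e'" "l' \<noteq> 0" "m' \<noteq> 0" "det2 c' e' \<noteq> 0"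
        "l' * m' * det2 c' e' ^ 3 = q" "I_O1 P' = tw q (cube_class (l' / m'))" .
    have "cube_class (l / m) = cube_class (l' / m')"
      using eq 1 2 tw_eq_iff[OF two q] by metis
    then show ?thesis
      unfolding 1(1) 2(1) using 1 2 by (intro orbit_eq_if_same_invariants) simp_all
  qed
  have "I_O1 P \<in> fibre (q\<^sup>2)" if P: "P \<in> OM (q\<^sup>2)" for P
  proof -
    from OM_normal_form[OF two three q P] obtain l c m e
      where "l \<noteq> 0" "m \<noteq> 0" "I_O1 P = tw q (cube_class (l / m))" .
    then show ?thesis unfolding fibre by auto
  qed
  moreover have "u \<in> I_O1 ` OM (q\<^sup>2)" if "u \<in> fibre (q\<^sup>2)" for u
  proof -
    obtain a where a: "a \<noteq> 0" "u = tw q (cube_class a)"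
      using \<open>u \<in> fibre (q\<^sup>2)\<close> unfolding fibre by auto
    show ?thesis using invariant_surjective[OF three q a(1)] unfolding a(2) by fastforce
  qed
  ultimately have image: "I_O1 ` OM (q\<^sup>2) = fibre (q\<^sup>2)" by blast
  have orbits: "SL2_orbits (q\<^sup>2) = SL2_orbit ` OM (q\<^sup>2)"
    unfolding orbits_def by auto
  have "I_orb ` SL2_orbits (q\<^sup>2) = I_O1 ` OM (q\<^sup>2)"
    unfolding orbits by (simp add: image_image I_orb cong: image_cong)
  moreover have "inj_on I_orb (SL2_orbits (q\<^sup>2))"
    unfolding orbits
  proof (rule inj_onI, elim imageE)
    fix \<Omega> \<Omega>' P P'
    assume "I_orb \<Omega> = I_orb \<Omega>'" and P: "\<Omega> = SL2_orbit P" "P \<in> OM (q\<^sup>2)" "\<Omega>' = SL2_orbit P'" "P' \<in> OM (q\<^sup>2)"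
    then have "I_O1 P = I_O1 P'" by (simp only: I_orb)
    with P show "\<Omega> = \<Omega>'" using inj by blast
  qed
  ultimately show ?thesis by (simp add: bij_betw_def image)
qed

lemma orbit_group_iso:
  fixes M :: "'a::field"
  assumes bij: "bij_betw I_orb (SL2_orbits M) (fibre M)" and grp: "group (fibre_group M)"
  shows "group (orbit_group M)" "I_orb \<in> iso (orbit_group M) (fibre_group M)"
    "I_orb \<one>\<^bsub>orbit_group M\<^esub> = \<one>\<^bsub>fibre_group M\<^esub>"
proof -
  interpret group "fibre_group M" by (rule grp)
  let ?f = "inv_into (SL2_orbits M) I_orb"
  have carrier: "carrier (fibre_group M) = fibre M" by (simp add: fibre_group_def)
  have I_f: "I_orb (?f u) = u" if "u \<in> fibre M" for u
    using that bij by (simp add: bij_betw_inv_into_right)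
  have f: "bij_betw ?f (carrier (fibre_group M)) (carrier (orbit_group M))"
    using bij_betw_inv_into[OF bij] by (simp add: carrier orbit_group_def)
  show "group (orbit_group M)"
    by (rule group_transport(1)[OF grp f]) (simp_all add: carrier orbit_group_def I_f)
  show "I_orb \<one>\<^bsub>orbit_group M\<^esub> = \<one>\<^bsub>fibre_group M\<^esub>"
    using one_closed by (simp add: carrier orbit_group_def I_f)
  show "I_orb \<in> iso (orbit_group M) (fibre_group M)"
  proof (rule isoI)
    show "bij_betw I_orb (carrier (orbit_group M)) (carrier (fibre_group M))"
      using bij by (simp add: carrier orbit_group_def)
    show "I_orb \<in> hom (orbit_group M) (fibre_group M)"
    proof (rule homI)
      fix x y assume "x \<in> carrier (orbit_group M)" "y \<in> carrier (orbit_group M)"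
      then have xy: "I_orb x \<in> carrier (fibre_group M)" "I_orb y \<in> carrier (fibre_group M)"
        using bij by (auto simp: orbit_group_def bij_betw_def carrier)
      show "I_orb x \<in> carrier (fibre_group M)" by (rule xy)
      show "I_orb (x \<otimes>\<^bsub>orbit_group M\<^esub> y) = I_orb x \<otimes>\<^bsub>fibre_group M\<^esub> I_orb y"
        using m_closed[OF xy] by (simp add: carrier orbit_group_def I_f)
    qed
  qed
qed

lemma two_three_nonzero:
  assumes "CHAR('a::field) \<noteq> 2" "CHAR('a) \<noteq> 3"
  shows "(2::'a) \<noteq> 0" "(3::'a) \<noteq> 0"
proof -
  have "of_nat p \<noteq> (0::'a)" if "prime p" "CHAR('a) \<noteq> p" for p
    using that CHAR_not_1[where ?'a = 'a] by (auto simp: of_nat_eq_0_iff_char_dvd prime_nat_iff)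
  from this[of 2] this[of 3] show "(2::'a) \<noteq> 0" "(3::'a) \<noteq> 0"
    using assms by simp_all
qed

theorem theorem3p34:
  fixes M :: "'a::field"
  assumes char2: "CHAR('a) \<noteq> 2" and char3: "CHAR('a) \<noteq> 3"
    and M: "M \<in> nonzero_squares"
  shows
    "(I_O1 \<in> O1 \<rightarrow> (twisted :: ('a \<times> 'a set) set set)
      \<and> (\<forall>P\<in>OM M. I_orb (SL2_orbit P) = I_O1 P)
      \<and> bij_betw I_orb (SL2_orbits M) (fibre M)
      \<and> group (orbit_group M)
      \<and> I_orb \<in> iso (orbit_group M) (fibre_group M))
     \<and> orbit_group M \<cong> (cube_classes :: 'a set monoid)
     \<and> (\<forall>q. q \<noteq> 0 \<and> q\<^sup>2 = M \<longrightarrow> (\<forall>P\<in>OM M.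
          (SL2_orbit P = \<one>\<^bsub>orbit_group M\<^esub> \<longleftrightarrow> \<not> irreducible P)
          \<and> (\<not> irreducible P \<longleftrightarrow> I_O1 P = tw q \<one>\<^bsub>cube_classes\<^esub>)))"
proof -
  note two = two_three_nonzero(1)[OF char2 char3] and three = two_three_nonzero(2)[OF char2 char3]
  obtain p where p: "p \<noteq> 0" "p\<^sup>2 = M" using M by (auto simp: nonzero_squares_def)
  have bij: "bij_betw I_orb (SL2_orbits M) (fibre M)"
    using I_orb_bij[OF two three p(1)] by (simp add: p(2))
  note fibre_iso = fibre_group_iso[OF two p]
  note orbit_iso = orbit_group_iso[OF bij fibre_iso(1)]
  have I_orb: "I_orb (SL2_orbit P) = I_O1 P" if "P \<in> OM M" for P
    using I_orb_orbit[OF two three] OM_subset_O1[OF M] that by blast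
  have "I_O1 P \<in> (twisted :: ('a \<times> 'a set) set set)" if P: "P \<in> O1" for P
  proof -
    from O1_normal_form[OF two three P] obtain l c m e
      where "P = cube_sum l c m e" "l \<noteq> 0" "m \<noteq> 0" "det2 c e \<noteq> 0" .
    then show ?thesis
      by (auto simp: I_O1_cube_sum[OF three] twisted_altdef intro!: exI cube_class_closed)
  qed
  then have range: "I_O1 \<in> O1 \<rightarrow> (twisted :: ('a \<times> 'a set) set set)" by blast
  have "orbit_group M \<cong> fibre_group M" "fibre_group M \<cong> (cube_classes :: 'a set monoid)"
    using orbit_iso(2) fibre_iso(2) group.iso_sym[OF group_cube_classes] by (auto simp: is_iso_def)
  then have iso: "orbit_group M \<cong> (cube_classes :: 'a set monoid)"
    by (rule iso_trans)
  have identity: "(SL2_orbit P = \<one>\<^bsub>orbit_group M\<^esub> \<longleftrightarrow> \<not> irreducible P)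
          \<and> (\<not> irreducible P \<longleftrightarrow> I_O1 P = tw q \<one>\<^bsub>cube_classes\<^esub>)"
    if q: "q \<noteq> 0" "q\<^sup>2 = M" and P: "P \<in> OM M" for q P
  proof -
    from OM_normal_form[OF two three q(1)] P q(2) obtain l c m e
      where nf: "P = cube_sum l c m e" "l \<noteq> 0" "m \<noteq> 0" "det2 c e \<noteq> 0"
        "I_O1 P = tw q (cube_class (l / m))" by metis
    have red: "\<not> irreducible P \<longleftrightarrow> I_O1 P = tw q \<one>\<^bsub>cube_classes\<^esub>"
      using cube_sum_reducible_iff[OF nf(2-4)] tw_eq_iff[OF two q(1)] unfolding nf(1,5)[symmetric]
      by (simp add: nf(5))
    have "SL2_orbit P \<in> SL2_orbits M" using P by (auto simp: orbits_def)
    moreover have "\<one>\<^bsub>orbit_group M\<^esub> \<in> SL2_orbits M"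
      using group.is_monoid[OF orbit_iso(1), THEN monoid.one_closed] by (simp add: orbit_group_def)
    ultimately have "SL2_orbit P = \<one>\<^bsub>orbit_group M\<^esub> \<longleftrightarrow> I_orb (SL2_orbit P) = I_orb \<one>\<^bsub>orbit_group M\<^esub>"
      using bij by (auto simp: bij_betw_def inj_on_def)
    also have "\<dots> \<longleftrightarrow> I_O1 P = tw q \<one>\<^bsub>cube_classes\<^esub>"
      by (simp add: I_orb[OF P] orbit_iso(3) fibre_one[OF q(2)])
    finally show ?thesis using red by blast
  qed
  show ?thesis
    using range I_orb bij orbit_iso(1,2) iso identity by blast
qed

end
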